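(* Consider the two-tier massive MIMO heterogeneous network described in the context and a typical user associated with a PBS. Let $R_s$ be the targeted secrecy rate. Let $R_{\mathrm P}=\mathbb E\{\log_2(1+\mathrm{SINR}_{\mathrm P})\}$ be the achievable ergodic rate of the picocell user, and let $\mathrm{SINR}^{\mathrm P}_{e^*}$ be the receive SINR at the most malicious eavesdropper. Then the secrecy outage probability of this typical user is $$P^{\mathrm P}_{out}(R_s)=\Pr\{R_{\mathrm P}-\log_2(1+\mathrm{SINR}^{\mathrm P}_{e^*})\le R_s\}=1-\mathbb F_{\mathrm{SINR}^{\mathrm P}_{e^*}}\!\left(2^{R_{\mathrm P}-R_s}-1\right),$$ where the CDF $\mathbb F_{\mathrm{SINR}^{\mathrm P}_{e^*}}$ of $\mathrm{SINR}^{\mathrm P}_{e^*}$ is, for $\gamma\ge0$, $$\mathbb F_{\mathrm{SINR}^{\mathrm P}_{e^*}}(\gamma)=\exp\Big\{-2\pi\lambda_{\mathrm E}\int_0^\infty\exp\{-E(x)\}\,x\,dx\Big\},$$ with $$E(x)=\frac{\gamma\delta^2x^{\alpha_2}}{\beta P_{\mathrm P}}+2\pi\lambda_{\mathrm M}\sum_{k=1}^{S}\binom{S}{k}\left(\frac{\gamma P_{\mathrm M}}{P_{\mathrm P}S}\right)^{2/\alpha_1}\frac{\Gamma(-k+\tfrac{2}{\alpha_1}+S)\,\Gamma(k-\tfrac{2}{\alpha_1})}{\alpha_1\Gamma(S)}\,x^{2\alpha_2/\alpha_1}+\frac{2\pi^2\lambda_{\mathrm P}}{\alpha_2}\gamm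a^{2/\alpha_2}\csc\!\left(\frac{2\pi}{\alpha_2}\right)x^2.$$
   Context: Network: in the plane, macrocell base stations (MBSs), picocell base stations (PBSs) and eavesdroppers are located according to independent homogeneous Poisson point processes $\Phi_{\mathrm M},\Phi_{\mathrm P},\Phi_{\mathrm E}$ with densities $\lambda_{\mathrm M},\lambda_{\mathrm P},\lambda_{\mathrm E}$. Each MBS has $N$ antennas, uses zero-forcing beamforming with equal power assignment, and serves $S$ single-antenna users simultaneously ($N\gg S\ge1$); each PBS is single-antenna and serves one single-antenna user. Transmit powers are $P_{\mathrm M}$ (MBS) and $P_{\mathrm P}$ (PBS); the noise power is $\delta^2$; all tiers share the same bandwidth. Path loss at distance $r$ is $L(r)=\beta r^{-\alpha_1}$ for MBS links and $L(r)=\beta r^{-\alpha_2}$ for PBS links, with $\alpha_1,\alpha_2>2$ and $\beta>0$. All fading gains are mutually independent (i.i.d. quasi-static Rayleigh fading). $\Gamma(k,1)$ as a distribution denotes the Gamma law with shape $k$ and unit scale. User association: the typical user at the origin is associated with the base station giving the maximum average received power, which is $(N-S+1)\frac{P_{\mathrm M}}{S}\beta r^{-\alpha_1}$ for an MBS at distance $r$ and $P_{\mathrm P}\beta r^{-\alpha_2}$ for a PBS at distance $r$. SINR of the picocell user: conditional on the typical user being associated with PBS $B_{o,\mathrm P}$ at (random) distance $|X_{o,\mathrm P}|$, $$\mathrm{SINR}_{\mathrm P}=\frac{P_{\mathrm P}g_{o,\mathrm P}\,\beta|X_{o,\mathrm P}|^{-\alpha_2}}{I_2+\delta^2},\qquad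 I_2=\sum_{\ell\in\Phi_{\mathrm M}}\frac{P_{\mathrm M}}{S}g_{\ell,\mathrm M}\,\beta|X_{\ell,\mathrm M}|^{-\alpha_1}+\sum_{j\in\Phi_{\mathrm P}\setminus B_{o,\mathrm P}}P_{\mathrm P}g_{j,\mathrm P}\,\beta|X_{j,\mathrm P}|^{-\alpha_2},$$ with $g_{o,\mathrm P}\sim\exp(1)$, $g_{\ell,\mathrm M}\sim\Gamma(S,1)$, $g_{j,\mathrm P}\sim\exp(1)$, and $|X_{\ell,\mathrm M}|,|X_{j,\mathrm P}|$ the distances from the user to MBS $\ell$ and PBS $j$. The expectation in $R_{\mathrm P}$ is conditional on PBS association. Eavesdropping: eavesdroppers are passive and non-colluding, so only the one with the largest receive SINR matters. When the PBS $o$ transmits to its intended user, $$\mathrm{SINR}^{\mathrm P}_{e^*}=\max_{e\in\Phi_{\mathrm E}}\frac{P_{\mathrm P}g_{o,e}L(|X_{o,e}|)}{I_{\mathrm M,\mathrm P,e}+I_{\mathrm S,\mathrm P,e}+\delta^2},$$ where $g_{o,e}\sim\exp(1)$, $|X_{o,e}|$ is the distance between eavesdropper $e$ and the targeted PBS, $I_{\mathrm M,\mathrm P,e}=\sum_{\ell\in\Phi_{\mathrm M}}\frac{P_{\mathrm M}}{S}g_{\ell,e}L(|X_{\ell,e}|)$ with $g_{\ell,e}\sim\Gamma(S,1)$, and $I_{\mathrm S,\mathrm P,e}=\sum_{j\in\Phi_{\mathrm P}\setminus o}P_{\mathrm P}g_{j,\mathrm P,e}L(|X_{j,\mathrm P,e}|)$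 with $g_{j,\mathrm P,e}\sim\exp(1)$; $|X_{\ell,e}|$ and $|X_{j,\mathrm P,e}|$ are the distances from the eavesdropper to MBS $\ell$ and PBS $j$. Secrecy outage is declared when the secrecy rate (the user's ergodic rate minus $\log_2(1+\mathrm{SINR}^{\mathrm P}_{e^*})$) is less than the targeted secrecy rate $R_s$.
   Formalization: With one shared Φ_M, Φ_P the CDF formula fails (e.g. large λ_E); here the user and each eavesdropper see their own independent copies of Φ_M and Φ_P, and the PBSs interfering at an eavesdropper form a full homogeneous Poisson process of density λ_P, independent of the serving PBS. *)

theory Defs
  imports "HOL-Probability.Probability"
begin

type_synonym plane = "real ^ 2"

text \<open>
  A point process of positive density on the plane is almost surely infinite and is represented by
  a measurable enumeration \<open>X 0, X 1, \<dots>\<close> of its points.  The counts of points in bounded Borel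
  sets determine the law of the process.
\<close>

definition poisson_process :: "'a measure \<Rightarrow> real \<Rightarrow> (nat \<Rightarrow> 'a \<Rightarrow> plane) \<Rightarrow> bool" where
  "poisson_process M \<rho> X \<longleftrightarrow>
     (\<forall>n. X n \<in> borel_measurable M) \<and>
     (\<forall>B\<in>sets borel. bounded B \<longrightarrow>
        (\<forall>k. measure M {\<omega>\<in>space M. finite {n. X n \<omega> \<in> B} \<and> card {n. X n \<omega> \<in> B} = k}
             = (\<rho> * measure lborel B) ^ k / fact k * exp (- (\<rho> * measure lborel B)))) \<and>
     (\<forall>B :: nat \<Rightarrow> plane set. disjoint_family B \<and> (\<forall>i. B i \<in> sets borel \<and> bounded (B i)) \<longrightarrow>
        prob_space.indep_vars M (\<lambda>_. count_space UNIV) (\<lambda>i \<omega>. card {n. X n \<omega> \<in> B i}) UNIV)"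

text \<open>
  If all eavesdroppers saw the same realisation of the base stations, their SINRs would be
  dependent, and the closed form below would (by Jensen's inequality) be only a lower bound of the
  distribution function of the largest SINR.  Similarly, the base stations around the serving PBS,
  conditional on its being chosen by the user, do not form homogeneous Poisson processes.  The
  closed form is exact when the interferers seen by different receivers are independent; the
  base-station processes therefore carry the receiver at which they are observed.
  \<open>PBS (Eve e)\<close> consists of the PBSs, other than the one that serves the typical user,
  seen by eavesdropper \<open>e\<close>; by Slivnyak's theorem removing a typical point leaves a Poisson
  process of the same density.
\<close>

datatype receiver = User | Eve nat

datatype process = MBS receiver | PBS receiver | Eves

text \<open>
  \<open>From_MBS i n\<close> and \<open>From_PBS i n\<close> are the links from the \<open>n\<close>-th point of \<open>MBS i\<close> and
  \<open>PBS i\<close> to the receiver \<open>i\<close>; \<open>Target e\<close> is the link from the PBS that serves the typical user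
  to eavesdropper \<open>e\<close>.
\<close>

datatype link = From_MBS receiver nat | From_PBS receiver nat | Target nat

record 'a hetnet =
  Om :: "'a measure"
  dens_M :: real
  dens_P :: real
  dens_E :: real
  pow_M :: real
  pow_P :: real
  alpha1 :: real
  alpha2 :: real
  beta :: real
  delta :: real  \<comment> \<open>the noise power is \<open>delta\<^sup>2\<close>\<close>
  antennas :: nat
  users :: nat
  pos :: "process \<Rightarrow> nat \<Rightarrow> 'a \<Rightarrow> plane"
  gain :: "link \<Rightarrow> 'a \<Rightarrow> real"

locale two_tier_network = prob_space "Om H" for H :: "'a hetnet" +
  assumes dens_pos: "dens_M H > 0" "dens_P H > 0" "dens_E H > 0"
    and pow_pos: "pow_M H > 0" "pow_P H > 0"
    and alpha_gt_2: "alpha1 H > 2" "alpha2 H > 2"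
    and beta_pos: "beta H > 0"
    and delta_pos: "delta H > 0"
    and users_ge_1: "1 \<le> users H"
    and users_le_antennas: "users H \<le> antennas H"
    and poisson_MBS: "\<And>i. poisson_process (Om H) (dens_M H) (pos H (MBS i))"
    and poisson_PBS: "\<And>i. poisson_process (Om H) (dens_P H) (pos H (PBS i))"
    and poisson_Eves: "poisson_process (Om H) (dens_E H) (pos H Eves)"
    \<comment> \<open>\<open>erlang_density (S - 1) 1\<close> is the density of the Gamma law with shape \<open>S\<close> and unit scale\<close>
    and gain_MBS: "\<And>i n. distributed (Om H) lborel (gain H (From_MBS i n))
                             (\<lambda>x. ennreal (erlang_density (users H - 1) 1 x))"
    and gain_PBS: "\<And>i n. distributed (Om H) lborel (gain H (From_PBS i n))
                             (\<lambda>x. ennreal (exponential_density 1 x))"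
    and gain_Target: "\<And>e. distributed (Om H) lborel (gain H (Target e))
                             (\<lambda>x. ennreal (exponential_density 1 x))"
    and processes_indep:
      "indep_vars (\<lambda>_. PiM UNIV (\<lambda>_. borel)) (\<lambda>p \<omega> n. pos H p n \<omega>) UNIV"
    and gains_indep: "indep_vars (\<lambda>_. borel) (gain H) UNIV"
    and gains_indep_processes:
      "indep_set
         (sets (vimage_algebra (space (Om H)) (\<lambda>\<omega> p n. pos H p n \<omega>)
                  (PiM UNIV (\<lambda>_. PiM UNIV (\<lambda>_. borel)))))
         (sets (vimage_algebra (space (Om H)) (\<lambda>\<omega> l. gain H l \<omega>) (PiM UNIV (\<lambda>_. borel))))"

definition path_loss :: "'a hetnet \<Rightarrow> real \<Rightarrow> real \<Rightarrow> real" where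
  "path_loss H a r = beta H * r powr (- a)"

definition avg_power_M :: "'a hetnet \<Rightarrow> real \<Rightarrow> real" where
  "avg_power_M H r =
     (real (antennas H) - real (users H) + 1) * (pow_M H / real (users H)) * path_loss H (alpha1 H) r"

definition avg_power_P :: "'a hetnet \<Rightarrow> real \<Rightarrow> real" where
  "avg_power_P H r = pow_P H * path_loss H (alpha2 H) r"

text \<open>The typical user is located at the origin.\<close>

definition serves_user :: "'a hetnet \<Rightarrow> 'a \<Rightarrow> nat \<Rightarrow> bool" where
  "serves_user H \<omega> n \<longleftrightarrow>
     (\<forall>m. avg_power_P H (norm (pos H (PBS User) m \<omega>)) \<le> avg_power_P H (norm (pos H (PBS User) n \<omega>))) \<and>
     (\<forall>l. avg_power_M H (norm (pos H (MBS User) l \<omega>)) \<le> avg_power_P H (norm (pos H (PBS User) n \<omega>)))"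

definition serving_PBS :: "'a hetnet \<Rightarrow> 'a \<Rightarrow> nat" where
  "serving_PBS H \<omega> = (LEAST n. serves_user H \<omega> n)"

definition target_pos :: "'a hetnet \<Rightarrow> 'a \<Rightarrow> plane" where
  "target_pos H \<omega> = pos H (PBS User) (serving_PBS H \<omega>) \<omega>"

text \<open>The probability measure conditional on the association of the typical user with a PBS.\<close>

definition given_PBS :: "'a hetnet \<Rightarrow> 'a measure" where
  "given_PBS H = uniform_measure (Om H) {\<omega>\<in>space (Om H). \<exists>n. serves_user H \<omega> n}"

text \<open>
  Interference at receiver \<open>i\<close> located at \<open>y\<close>; both series converge almost surely because the path
  loss exponents exceed 2.
\<close>

definition interference_M :: "'a hetnet \<Rightarrow> receiver \<Rightarrow> plane \<Rightarrow> 'a \<Rightarrow> real" where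
  "interference_M H i y \<omega> =
     (\<Sum>n. pow_M H / real (users H) * gain H (From_MBS i n) \<omega> *
           path_loss H (alpha1 H) (dist (pos H (MBS i) n \<omega>) y))"

definition interference_P :: "'a hetnet \<Rightarrow> receiver \<Rightarrow> nat set \<Rightarrow> plane \<Rightarrow> 'a \<Rightarrow> real" where
  "interference_P H i J y \<omega> =
     (\<Sum>n. if n \<in> J then pow_P H * gain H (From_PBS i n) \<omega> *
                         path_loss H (alpha2 H) (dist (pos H (PBS i) n \<omega>) y)
           else 0)"

definition SINR_P :: "'a hetnet \<Rightarrow> 'a \<Rightarrow> real" where
  "SINR_P H \<omega> =
     pow_P H * gain H (From_PBS User (serving_PBS H \<omega>)) \<omega> *
       path_loss H (alpha2 H) (norm (target_pos H \<omega>)) /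
     (interference_M H User 0 \<omega> + interference_P H User (- {serving_PBS H \<omega>}) 0 \<omega> + (delta H)\<^sup>2)"

definition rate_P :: "'a hetnet \<Rightarrow> real" where
  "rate_P H = (\<integral>\<omega>. log 2 (1 + SINR_P H \<omega>) \<partial>given_PBS H)"

definition SINR_eve :: "'a hetnet \<Rightarrow> nat \<Rightarrow> 'a \<Rightarrow> real" where
  "SINR_eve H e \<omega> = (let y = pos H Eves e \<omega> in
     pow_P H * gain H (Target e) \<omega> * path_loss H (alpha2 H) (dist (target_pos H \<omega>) y) /
     (interference_M H (Eve e) y \<omega> + interference_P H (Eve e) UNIV y \<omega> + (delta H)\<^sup>2))"

text \<open>
  Almost surely this supremum is a maximum: for every positive threshold only finitely many
  eavesdroppers exceed it.
\<close>

definition SINR_eve_max :: "'a hetnet \<Rightarrow> 'a \<Rightarrow> real" where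
  "SINR_eve_max H \<omega> = (SUP e. SINR_eve H e \<omega>)"

definition secrecy_outage :: "'a hetnet \<Rightarrow> real \<Rightarrow> real" where
  "secrecy_outage H Rs =
     measure (given_PBS H)
       {\<omega>\<in>space (given_PBS H). rate_P H - log 2 (1 + SINR_eve_max H \<omega>) \<le> Rs}"

definition cdf_SINR_eve_max :: "'a hetnet \<Rightarrow> real \<Rightarrow> real" where
  "cdf_SINR_eve_max H = cdf (distr (given_PBS H) borel (SINR_eve_max H))"

definition exponent :: "'a hetnet \<Rightarrow> real \<Rightarrow> real \<Rightarrow> real" where
  "exponent H \<gamma> x =
     \<gamma> * (delta H)\<^sup>2 * x powr alpha2 H / (beta H * pow_P H)
     + 2 * pi * dens_M H *
       (\<Sum>k = 1..users H. real (users H choose k)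
          * (\<gamma> * pow_M H / (pow_P H * real (users H))) powr (2 / alpha1 H)
          * (Gamma (- real k + 2 / alpha1 H + real (users H)) * Gamma (real k - 2 / alpha1 H)
             / (alpha1 H * Gamma (real (users H))))
          * x powr (2 * alpha2 H / alpha1 H))
     + 2 * pi\<^sup>2 * dens_P H / alpha2 H * \<gamma> powr (2 / alpha2 H) * (1 / sin (2 * pi / alpha2 H)) * x\<^sup>2"

text \<open>
  The integral in the closed form diverges for \<open>\<gamma> = 0\<close>, so it is taken in the extended nonnegative
  reals, with \<open>exp (- \<infinity>) = 0\<close>.
\<close>

definition exp_neg :: "ennreal \<Rightarrow> real" where
  "exp_neg t = (if t = \<infinity> then 0 else exp (- enn2real t))"

end

(* Conditional on everything seen by the user, eavesdropper e at distance x from the serving PBS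
   exceeds the threshold \<gamma> with probability h(x) = exp (- E(x)): the exponential gain of the target link
   turns this probability into the Laplace transform of interference plus noise at \<gamma> / (P L(x)), the
   Gamma gains turn it into a Laplace functional of the base station processes, and the radial
   integrals are Beta integrals.  Since different eavesdroppers see independent interferers, the
   probability that none exceeds \<gamma> is the expectation of \<Prod>\<^sub>e (1 - h(x\<^sub>e)), again a Laplace functional,
   now of the eavesdropper process.  It does not depend on the position of the serving PBS, so conditioning
   on the association has no effect.  It tends to 1 as \<gamma> grows, so the supremum of the SINRs is almost
   surely finite, and it is continuous in \<gamma>, so the non-strict inequality in the outage event does
   not matter. *)

theory Submission
  imports Defs
begin

subsection \<open>Resampling blocks of independent random elements\<close>

lemma exp_neg_ennreal: "0 \<le> x \<Longrightarrow> exp_neg (ennreal x) = exp (- x)"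
  by (simp add: exp_neg_def)

lemma exp_neg_top [simp]: "exp_neg \<top> = 0"
  by (simp add: exp_neg_def)

lemma exp_neg_0 [simp]: "exp_neg 0 = 1"
  by (simp add: exp_neg_def)

lemma exp_neg_nonneg [simp]: "0 \<le> exp_neg x"
  by (simp add: exp_neg_def)

lemma exp_neg_le_1 [simp]: "exp_neg x \<le> 1"
  by (simp add: exp_neg_def)

lemma exp_neg_add: "exp_neg (x + y) = exp_neg x * exp_neg y"
  by (cases x; cases y) (auto simp: exp_neg_ennreal exp_add[symmetric] simp flip: ennreal_plus)

lemma exp_neg_sum: "exp_neg (sum f A) = (\<Prod>i\<in>A. exp_neg (f i))"
  by (induction A rule: infinite_finite_induct) (auto simp: exp_neg_add)

lemma exp_neg_antimono: "x \<le> y \<Longrightarrow> exp_neg y \<le> exp_neg x"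
  by (cases x; cases y) (auto simp: exp_neg_ennreal top_unique)

lemma tendsto_exp_neg: "(f \<longlongrightarrow> l) F \<Longrightarrow> ((\<lambda>x. exp_neg (f x)) \<longlongrightarrow> exp_neg l) F"
proof (cases l)
  case (real r)
  assume lim: "(f \<longlongrightarrow> l) F"
  have "eventually (\<lambda>x. f x < \<top>) F"
    using order_tendstoD(2)[OF lim, of \<top>] real by simp
  moreover have "((\<lambda>x. exp (- enn2real (f x))) \<longlongrightarrow> exp (- enn2real l)) F"
    using lim real by (intro tendsto_intros tendsto_enn2real) auto
  ultimately show ?thesis
    unfolding exp_neg_def using real by (auto elim!: Lim_transform_eventually eventually_mono)
next
  case top
  assume lim: "(f \<longlongrightarrow> l) F"
  show ?thesis
    unfolding top exp_neg_top
  proof (rule order_tendstoI)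
    fix e :: real assume "0 < e"
    define r where "r = max 0 (- ln e)"
    have "eventually (\<lambda>x. ennreal r < f x) F"
      using order_tendstoD(1)[OF lim, of "ennreal r"] top by simp
    then show "eventually (\<lambda>x. exp_neg (f x) < e) F"
    proof eventually_elim
      case (elim x)
      show ?case
      proof (cases "f x")
        case (real s)
        moreover have "0 \<le> r" by (simp add: r_def)
        ultimately have "r < s" using elim by (simp add: ennreal_less_iff)
        then have "exp (- s) < exp (ln e)" by (simp add: r_def)
        then show ?thesis using real \<open>0 < e\<close> by (simp add: exp_neg_ennreal)
      qed (use \<open>0 < e\<close> in auto)
    qed
  qed (auto intro!: always_eventually order.strict_trans2[OF _ exp_neg_nonneg])
qed

lemma continuous_exp_neg: "continuous_on UNIV exp_neg"
  unfolding continuous_on_def using tendsto_exp_neg[OF tendsto_ident_at] by auto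

lemma measurable_exp_neg [measurable]: "exp_neg \<in> borel_measurable borel"
  by (rule borel_measurable_continuous_onI[OF continuous_exp_neg])

lemma exp_neg_suminf: "(\<lambda>N. \<Prod>n<N. exp_neg (f n)) \<longlonglongrightarrow> exp_neg (\<Sum>n. f n)"
  using tendsto_exp_neg[OF summable_LIMSEQ[OF summableI, of f]] by (simp add: exp_neg_sum)

definition depends_only :: "'i set \<Rightarrow> (('i \<Rightarrow> 'b) \<Rightarrow> 'c) \<Rightarrow> bool" where
  "depends_only J F \<longleftrightarrow> (\<forall>u v. (\<forall>i\<in>J. u i = v i) \<longrightarrow> F u = F v)"

context prob_space
begin

lemma nn_integral_indep_set:
  assumes X [measurable]: "X \<in> measurable M S" and Y [measurable]: "Y \<in> measurable M T"
    and ind: "indep_set (sigma_sets (space M) {X -` A \<inter> space M |A. A \<in> sets S})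
      (sigma_sets (space M) {Y -` A \<inter> space M |A. A \<in> sets T})"
    and [measurable]: "f \<in> borel_measurable (S \<Otimes>\<^sub>M T)"
  shows "(\<integral>\<^sup>+\<omega>. f (X \<omega>, Y \<omega>) \<partial>M) = (\<integral>\<^sup>+\<omega>. \<integral>\<^sup>+\<omega>'. f (X \<omega>, Y \<omega>') \<partial>M \<partial>M)"
proof -
  interpret X: prob_space "distr M S X" by (rule prob_space_distr) simp
  interpret Y: prob_space "distr M T Y" by (rule prob_space_distr) simp
  have "distr M S X \<Otimes>\<^sub>M distr M T Y = distr M (S \<Otimes>\<^sub>M T) (\<lambda>x. (X x, Y x))"
  proof (rule pair_measure_eqI)
    fix A B assume AB: "A \<in> sets (distr M S X)" "B \<in> sets (distr M T Y)"
    then have "prob (X -` A \<inter> space M \<inter> (Y -` B \<inter> space M)) = prob (X -` A \<inter> space M) * prob (Y -` B \<inter> space M)"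
      by (intro indep_setD[OF ind] sigma_sets.Basic) auto
    moreover have "(\<lambda>x. (X x, Y x)) -` (A \<times> B) \<inter> space M = X -` A \<inter> space M \<inter> (Y -` B \<inter> space M)"
      by auto
    ultimately show "emeasure (distr M S X) A * emeasure (distr M T Y) B =
        emeasure (distr M (S \<Otimes>\<^sub>M T) (\<lambda>x. (X x, Y x))) (A \<times> B)"
      using AB by (simp add: emeasure_distr emeasure_eq_measure ennreal_mult)
  qed (auto simp: X.sigma_finite_measure_axioms Y.sigma_finite_measure_axioms)
  then have "(\<integral>\<^sup>+\<omega>. f (X \<omega>, Y \<omega>) \<partial>M) = (\<integral>\<^sup>+z. f z \<partial>(distr M S X \<Otimes>\<^sub>M distr M T Y))"
    by (simp add: nn_integral_distr)
  also have "\<dots> = (\<integral>\<^sup>+x. \<integral>\<^sup>+y. f (x, y) \<partial>distr M T Y \<partial>distr M S X)"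
    by (subst Y.nn_integral_fst[symmetric]) auto
  also have "\<dots> = (\<integral>\<^sup>+\<omega>. \<integral>\<^sup>+\<omega>'. f (X \<omega>, Y \<omega>') \<partial>M \<partial>M)"
    using measurable_space[OF X]
    by (subst nn_integral_distr, simp, simp, intro nn_integral_cong, subst nn_integral_distr) auto
  finally show ?thesis .
qed

lemma nn_integral_indep_var:
  assumes "indep_var S X T Y" "f \<in> borel_measurable (S \<Otimes>\<^sub>M T)"
  shows "(\<integral>\<^sup>+\<omega>. f (X \<omega>, Y \<omega>) \<partial>M) = (\<integral>\<^sup>+\<omega>. \<integral>\<^sup>+\<omega>'. f (X \<omega>, Y \<omega>') \<partial>M \<partial>M)"
  using assms by (intro nn_integral_indep_set) (auto simp: indep_var_eq)

lemma nn_integral_resample: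
  assumes ind: "indep_vars M' X UNIV" and [measurable]: "F \<in> borel_measurable (PiM UNIV M')"
  shows "(\<integral>\<^sup>+\<omega>. F (\<lambda>i. X i \<omega>) \<partial>M) =
    (\<integral>\<^sup>+\<omega>. \<integral>\<^sup>+\<omega>'. F (\<lambda>i. if i \<in> J then X i \<omega>' else X i \<omega>) \<partial>M \<partial>M)"
proof -
  let ?m = "\<lambda>(u, v) i. if i \<in> J then v i else u i"
  have m: "?m \<in> measurable (PiM (-J) M' \<Otimes>\<^sub>M PiM J M') (PiM UNIV M')"
    unfolding case_prod_beta
  proof (rule measurable_PiM_single')
    fix i
    show "(\<lambda>w. if i \<in> J then snd w i else fst w i) \<in> measurable (PiM (-J) M' \<Otimes>\<^sub>M PiM J M') (M' i)"
      by (cases "i \<in> J") auto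
  qed (auto simp: space_pair_measure space_PiM PiE_iff)
  have "(\<integral>\<^sup>+\<omega>. F (\<lambda>i. X i \<omega>) \<partial>M)
    = (\<integral>\<^sup>+\<omega>. F (?m (restrict (\<lambda>i. X i \<omega>) (-J), restrict (\<lambda>i. X i \<omega>) J)) \<partial>M)"
    by (intro nn_integral_cong arg_cong[of _ _ F]) auto
  also have "\<dots> = (\<integral>\<^sup>+\<omega>. \<integral>\<^sup>+\<omega>'. F (?m (restrict (\<lambda>i. X i \<omega>) (-J), restrict (\<lambda>i. X i \<omega>') J)) \<partial>M \<partial>M)"
    using m by (intro nn_integral_indep_var[OF indep_var_restrict[OF ind], where f="\<lambda>z. F (?m z)"])
      (auto intro: measurable_compose)
  also have "\<dots> = (\<integral>\<^sup>+\<omega>. \<integral>\<^sup>+\<omega>'. F (\<lambda>i. if i \<in> J then X i \<omega>' else X i \<omega>) \<partial>M \<partial>M)"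
    by (intro nn_integral_cong arg_cong[of _ _ F]) auto
  finally show ?thesis .
qed

lemma measurable_indep_family:
  assumes "indep_vars M' X UNIV"
  shows "(\<lambda>\<omega> i. X i \<omega>) \<in> measurable M (PiM UNIV M')"
  using assms by (intro measurable_PiM_single') (auto simp: indep_vars_def space_PiM intro: measurable_space)

lemma nn_integral_mult_blocks:
  assumes ind: "indep_vars M' X UNIV"
    and [measurable]: "F \<in> borel_measurable (PiM UNIV M')" "G \<in> borel_measurable (PiM UNIV M')"
    and F: "depends_only J F" and G: "depends_only K G" and "J \<inter> K = {}"
  shows "(\<integral>\<^sup>+\<omega>. F (\<lambda>i. X i \<omega>) * G (\<lambda>i. X i \<omega>) \<partial>M) =
    (\<integral>\<^sup>+\<omega>. F (\<lambda>i. X i \<omega>) \<partial>M) * (\<integral>\<^sup>+\<omega>. G (\<lambda>i. X i \<omega>) \<partial>M)"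
proof -
  note m = measurable_compose[OF measurable_indep_family[OF ind]]
  note [measurable] = m[OF assms(2)] m[OF assms(3)]
  let ?r = "\<lambda>\<omega> \<omega>' i. if i \<in> K then X i \<omega>' else X i \<omega>"
  have "F (?r \<omega> \<omega>') = F (\<lambda>i. X i \<omega>)" "G (?r \<omega> \<omega>') = G (\<lambda>i. X i \<omega>')" for \<omega> \<omega>'
    using assms(6) by (auto intro!: F[unfolded depends_only_def, rule_format] G[unfolded depends_only_def, rule_format])
  then have "(\<integral>\<^sup>+\<omega>. F (\<lambda>i. X i \<omega>) * G (\<lambda>i. X i \<omega>) \<partial>M) =
      (\<integral>\<^sup>+\<omega>. \<integral>\<^sup>+\<omega>'. F (\<lambda>i. X i \<omega>) * G (\<lambda>i. X i \<omega>') \<partial>M \<partial>M)"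
    by (subst nn_integral_resample[OF ind, of "\<lambda>x. F x * G x" K]) simp_all
  also have "\<dots> = (\<integral>\<^sup>+\<omega>. F (\<lambda>i. X i \<omega>) \<partial>M) * (\<integral>\<^sup>+\<omega>. G (\<lambda>i. X i \<omega>) \<partial>M)"
    by (simp add: nn_integral_cmult nn_integral_multc)
  finally show ?thesis .
qed

lemma nn_integral_prod_blocks:
  assumes ind: "indep_vars M' X UNIV"
    and [measurable]: "\<And>e. F e \<in> borel_measurable (PiM UNIV M')"
    and F: "\<And>e. depends_only (J e) (F e)" and J: "disjoint_family J"
  shows "(\<integral>\<^sup>+\<omega>. (\<Prod>e<K. F e (\<lambda>i. X i \<omega>)) \<partial>M) = (\<Prod>e<(K::nat). \<integral>\<^sup>+\<omega>. F e (\<lambda>i. X i \<omega>) \<partial>M)"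
proof (induction K)
  case (Suc K)
  have "depends_only (\<Union>e<K. J e) (\<lambda>x. \<Prod>e<K. F e x)"
    using F unfolding depends_only_def by (auto intro!: prod.cong)
  moreover have "(\<Union>e<K. J e) \<inter> J K = {}"
    using disjoint_family_onD[OF J, of _ K] by fastforce
  ultimately show ?case
    using nn_integral_mult_blocks[OF ind, of "\<lambda>x. \<Prod>e<K. F e x" "F K" "\<Union>e<K. J e" "J K"] F Suc by simp
qed (simp add: emeasure_space_1)

end

subsection \<open>The Laplace functional of a Poisson process\<close>

context prob_space
begin

context
  fixes \<rho> :: real and X :: "nat \<Rightarrow> 'a \<Rightarrow> plane"
  assumes pp: "poisson_process M \<rho> X" and \<rho>: "0 \<le> \<rho>"
begin

lemma measurable_poisson: "X n \<in> borel_measurable M"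
  using pp by (simp add: poisson_process_def)

lemma measurable_poisson_finite:
  assumes [measurable]: "B \<in> sets borel"
  shows "{\<omega>\<in>space M. finite {n. X n \<omega> \<in> B}} \<in> sets M"
  using measurable_poisson [measurable] unfolding finite_nat_set_iff_bounded by simp

lemma measurable_poisson_card:
  assumes "B \<in> sets borel" "bounded B"
  shows "(\<lambda>\<omega>. card {n. X n \<omega> \<in> B}) \<in> measurable M (count_space UNIV)"
proof -
  have "indep_vars (\<lambda>_. count_space UNIV) (\<lambda>i \<omega>. card {n. X n \<omega> \<in> (if i = (0::nat) then B else {})}) UNIV"
    using pp assms by (intro pp[unfolded poisson_process_def, THEN conjunct2, THEN conjunct2, rule_format])
      (auto simp: disjoint_family_on_def)
  then show ?thesis
    unfolding indep_vars_def by (elim conjE ballE[of _ _ 0]) auto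
qed

lemma nn_integral_poisson_count:
  fixes h :: "nat \<Rightarrow> ennreal"
  assumes B: "B \<in> sets borel" "bounded B"
  shows "(\<integral>\<^sup>+\<omega>. h (card {n. X n \<omega> \<in> B}) * indicator {\<omega>. finite {n. X n \<omega> \<in> B}} \<omega> \<partial>M) =
    (\<Sum>k. h k * ennreal ((\<rho> * measure lborel B) ^ k / fact k * exp (- (\<rho> * measure lborel B))))"
proof -
  define N where "N \<omega> = {n. X n \<omega> \<in> B}" for \<omega>
  define E where "E k = {\<omega>\<in>space M. finite (N \<omega>)} \<inter> ((\<lambda>\<omega>. card (N \<omega>)) -` {k} \<inter> space M)" for k
  have [measurable]: "E k \<in> sets M" for k
    unfolding E_def N_def
    by (intro sets.Int measurable_poisson_finite[OF B(1)] measurable_sets[OF measurable_poisson_card[OF B]]) simp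
  have E: "measure M (E k) = (\<rho> * measure lborel B) ^ k / fact k * exp (- (\<rho> * measure lborel B))" for k
    unfolding pp[unfolded poisson_process_def, THEN conjunct2, THEN conjunct1, rule_format, OF B, symmetric]
    by (rule arg_cong[of _ _ "measure M"]) (auto simp: E_def N_def)
  have "(\<Sum>k. h k * indicator (E k) \<omega>) = h (card (N \<omega>)) * indicator {\<omega>. finite (N \<omega>)} \<omega>"
    if "\<omega> \<in> space M" for \<omega>
  proof -
    have "indicator (E k) \<omega> = (indicator {card (N \<omega>)} k * indicator {\<omega>. finite (N \<omega>)} \<omega> :: ennreal)" for k
      using that by (cases "finite (N \<omega>)") (auto simp: E_def split: split_indicator)
    note E_ind = this
    have "(\<Sum>k. h k * indicator (E k) \<omega>) = (\<Sum>k\<in>{card (N \<omega>)}. h k * indicator (E k) \<omega>)"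
      by (rule suminf_finite) (simp_all add: E_ind)
    then show ?thesis
      by (cases "finite (N \<omega>)") (simp_all add: E_ind)
  qed
  then have "(\<integral>\<^sup>+\<omega>. h (card (N \<omega>)) * indicator {\<omega>. finite (N \<omega>)} \<omega> \<partial>M) =
      (\<integral>\<^sup>+\<omega>. (\<Sum>k. h k * indicator (E k) \<omega>) \<partial>M)"
    by (intro nn_integral_cong) simp
  also have "\<dots> = (\<Sum>k. h k * emeasure M (E k))"
    by (subst nn_integral_suminf) (simp_all add: nn_integral_cmult)
  finally show ?thesis
    by (simp add: emeasure_eq_measure E N_def)
qed

lemma suminf_poisson_pgf:
  assumes "0 \<le> z" "0 \<le> \<mu>"
  shows "(\<Sum>k. ennreal (z ^ k) * ennreal (\<mu> ^ k / fact k * exp (- \<mu>))) = ennreal (exp (- (\<mu> * (1 - z))))"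
proof -
  have "(\<lambda>k. (z * \<mu>) ^ k /\<^sub>R fact k * exp (- \<mu>)) sums (exp (z * \<mu>) * exp (- \<mu>))"
    by (intro sums_mult2 exp_converges)
  then have "(\<lambda>k. z ^ k * (\<mu> ^ k / fact k * exp (- \<mu>))) sums exp (- (\<mu> * (1 - z)))"
    by (simp add: exp_add[symmetric] algebra_simps power_mult_distrib divide_inverse)
  then show ?thesis
    using assms by (subst ennreal_mult'[symmetric]) (auto intro!: suminf_ennreal_eq)
qed

lemma AE_poisson_finite:
  assumes B: "B \<in> sets borel" "bounded B"
  shows "AE \<omega> in M. finite {n. X n \<omega> \<in> B}"
proof -
  note [measurable] = measurable_poisson_finite[OF B(1)]
  have "emeasure M {\<omega>\<in>space M. finite {n. X n \<omega> \<in> B}} =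
      (\<integral>\<^sup>+\<omega>. indicator {\<omega>\<in>space M. finite {n. X n \<omega> \<in> B}} \<omega> \<partial>M)"
    by (rule nn_integral_indicator[OF measurable_poisson_finite[OF B(1)], symmetric])
  also have "\<dots> = (\<integral>\<^sup>+\<omega>. 1 * indicator {\<omega>. finite {n. X n \<omega> \<in> B}} \<omega> \<partial>M)"
    by (intro nn_integral_cong) (simp add: indicator_def)
  also have "\<dots> = (\<Sum>k. ennreal (1 ^ k) * ennreal ((\<rho> * measure lborel B) ^ k / fact k * exp (- (\<rho> * measure lborel B))))"
    unfolding nn_integral_poisson_count[OF B, of "\<lambda>_. 1"] by simp
  also have "\<dots> = 1"
    using \<rho> by (subst suminf_poisson_pgf) simp_all
  finally have "prob {\<omega>\<in>space M. finite {n. X n \<omega> \<in> B}} = 1"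
    by (simp add: emeasure_eq_measure)
  then have "AE \<omega> in M. \<omega> \<in> {\<omega>\<in>space M. finite {n. X n \<omega> \<in> B}}"
    using prob_eq_1[OF measurable_poisson_finite[OF B(1)]] by blast
  then show ?thesis
    by (rule eventually_mono) blast
qed

lemma poisson_pgf:
  assumes B: "B \<in> sets borel" "bounded B" and "0 \<le> z"
  shows "(\<integral>\<^sup>+\<omega>. ennreal (z ^ card {n. X n \<omega> \<in> B}) \<partial>M) = ennreal (exp (- (\<rho> * measure lborel B * (1 - z))))"
proof -
  have "(\<integral>\<^sup>+\<omega>. ennreal (z ^ card {n. X n \<omega> \<in> B}) \<partial>M) =
     (\<integral>\<^sup>+\<omega>. ennreal (z ^ card {n. X n \<omega> \<in> B}) * indicator {\<omega>. finite {n. X n \<omega> \<in> B}} \<omega> \<partial>M)"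
    using AE_poisson_finite[OF B] by (intro nn_integral_cong_AE) (auto elim: eventually_mono)
  then show ?thesis
    using nn_integral_poisson_count[OF B, of "\<lambda>k. ennreal (z ^ k)"] suminf_poisson_pgf[of z "\<rho> * measure lborel B"]
      \<rho> \<open>0 \<le> z\<close> by simp
qed

lemma exp_neg_mult_of_nat: "exp_neg (c * of_nat k) = exp_neg c ^ k"
  by (induction k) (auto simp: distrib_left exp_neg_add)

lemma poisson_laplace_simple:
  fixes c :: "nat \<Rightarrow> ennreal" and B :: "nat \<Rightarrow> plane set"
  assumes B: "disjoint_family B" "\<And>i. B i \<in> sets borel" "\<And>i. bounded (B i)"
  shows "(\<integral>\<^sup>+\<omega>. ennreal (exp_neg (\<Sum>n. \<Sum>i<m. c i * indicator (B i) (X n \<omega>))) \<partial>M) =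
    ennreal (exp_neg (ennreal \<rho> * (\<integral>\<^sup>+x. ennreal (1 - exp_neg (\<Sum>i<m. c i * indicator (B i) x)) \<partial>lborel)))"
proof -
  let ?N = "\<lambda>i \<omega>. card {n. X n \<omega> \<in> B i}"
  note [measurable] = B(2)
  have ind: "indep_vars (\<lambda>_. count_space UNIV) ?N UNIV"
    by (rule pp[unfolded poisson_process_def, THEN conjunct2, THEN conjunct2, rule_format]) (simp add: B)
  have fin: "emeasure lborel (B i) = ennreal (measure lborel (B i))" for i
    using emeasure_bounded_finite[OF B(3), of i] by (simp add: emeasure_eq_ennreal_measure)
  have "(\<integral>\<^sup>+\<omega>. ennreal (exp_neg (\<Sum>n. \<Sum>i<m. c i * indicator (B i) (X n \<omega>))) \<partial>M) =
     (\<integral>\<^sup>+\<omega>. (\<Prod>i<m. ennreal (exp_neg (c i) ^ ?N i \<omega>)) \<partial>M)"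
  proof (rule nn_integral_cong_AE)
    have "AE \<omega> in M. \<forall>i. finite {n. X n \<omega> \<in> B i}"
      using AE_poisson_finite[OF B(2,3)] by (simp add: AE_all_countable)
    then show "AE \<omega> in M. ennreal (exp_neg (\<Sum>n. \<Sum>i<m. c i * indicator (B i) (X n \<omega>))) =
        (\<Prod>i<m. ennreal (exp_neg (c i) ^ ?N i \<omega>))"
    proof eventually_elim
      case (elim \<omega>)
      have "(\<Sum>n. indicator (B i) (X n \<omega>)) = (of_nat (?N i \<omega>) :: ennreal)" for i
        using suminf_finite[of "{n. X n \<omega> \<in> B i}" "\<lambda>n. indicator (B i) (X n \<omega>) :: ennreal"] elim by simp
      then have "(\<Sum>n. \<Sum>i<m. c i * indicator (B i) (X n \<omega>)) = (\<Sum>i<m. c i * of_nat (?N i \<omega>))"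
        by (subst suminf_sum) (auto simp: ennreal_suminf_cmult)
      then show ?case
        by (simp add: exp_neg_sum exp_neg_mult_of_nat prod_ennreal)
    qed
  qed
  also have "\<dots> = (\<Prod>i<m. \<integral>\<^sup>+\<omega>. ennreal (exp_neg (c i) ^ ?N i \<omega>) \<partial>M)"
  proof (rule nn_integral_prod_blocks[OF ind, where F = "\<lambda>i u. ennreal (exp_neg (c i) ^ u i)" and J = "\<lambda>i. {i}"])
    fix i
    show "(\<lambda>u. ennreal (exp_neg (c i) ^ u i)) \<in> borel_measurable (PiM UNIV (\<lambda>_. count_space UNIV))"
      by (rule measurable_compose[OF measurable_component_singleton]) simp_all
  qed (simp_all add: depends_only_def disjoint_family_on_def)
  also have "\<dots> = (\<Prod>i<m. ennreal (exp (- (\<rho> * measure lborel (B i) * (1 - exp_neg (c i))))))"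
    by (intro prod.cong refl poisson_pgf B) simp
  also have "\<dots> = ennreal (exp (- (\<rho> * (\<Sum>i<m. (1 - exp_neg (c i)) * measure lborel (B i)))))"
    by (simp add: prod_ennreal exp_sum[symmetric] sum_distrib_left sum_negf ac_simps)
  also have "\<dots> = ennreal (exp_neg (ennreal \<rho> * ennreal (\<Sum>i<m. (1 - exp_neg (c i)) * measure lborel (B i))))"
    using \<rho> by (subst ennreal_mult[symmetric]) (auto simp: exp_neg_ennreal sum_nonneg)
  also have "ennreal (\<Sum>i<m. (1 - exp_neg (c i)) * measure lborel (B i)) =
      (\<integral>\<^sup>+x. (\<Sum>i<m. ennreal (1 - exp_neg (c i)) * indicator (B i) x) \<partial>lborel)"
    by (subst nn_integral_sum) (simp_all add: nn_integral_cmult fin ennreal_mult' sum_ennreal[symmetric])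
  also have "\<dots> = (\<integral>\<^sup>+x. ennreal (1 - exp_neg (\<Sum>i<m. c i * indicator (B i) x)) \<partial>lborel)"
  proof (rule nn_integral_cong)
    fix x
    show "(\<Sum>i<m. ennreal (1 - exp_neg (c i)) * indicator (B i) x) = ennreal (1 - exp_neg (\<Sum>i<m. c i * indicator (B i) x))"
    proof (cases "\<exists>j<m. x \<in> B j")
      case True
      then obtain j where j: "j < m" "x \<in> B j" by blast
      have "x \<notin> B i" if "i \<noteq> j" for i
        using disjoint_family_onD[OF B(1), of i j] that j by auto
      then have "(\<Sum>i<m. d i * indicator (B i) x) = d j" for d :: "nat \<Rightarrow> ennreal"
        using j by (subst sum.mono_neutral_right[of _ "{j}"]) auto
      then show ?thesis by simp
    qed (auto intro!: sum.neutral)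
  qed
  finally show ?thesis .
qed

lemma poisson_laplace_simple_function:
  assumes g: "simple_function borel g" and bnd: "bounded {x. g x \<noteq> 0}"
  shows "(\<integral>\<^sup>+\<omega>. ennreal (exp_neg (\<Sum>n. g (X n \<omega>))) \<partial>M) =
    ennreal (exp_neg (ennreal \<rho> * (\<integral>\<^sup>+x. ennreal (1 - exp_neg (g x)) \<partial>lborel)))"
proof -
  have fin: "finite (range g - {0})"
    using simple_functionD(1)[OF g] by simp
  then obtain c where c: "bij_betw c {..<card (range g - {0})} (range g - {0})"
    using ex_bij_betw_nat_finite[OF fin] unfolding atLeast0LessThan by blast
  define m where "m = card (range g - {0})"
  define B where "B i = (if i < m then g -` {c i} else {})" for i
  have "i = j" if "x \<in> B i" "x \<in> B j" for i j x
    using inj_onD[OF bij_betw_imp_inj_on[OF c], of i j] that by (simp add: B_def m_def split: if_splits)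
  then have "disjoint_family B"
    unfolding disjoint_family_on_def by blast
  moreover have "B i \<in> sets borel" for i
    using simple_functionD(2)[OF g, of "{c i}"] by (simp add: B_def)
  moreover have "bounded (B i)" for i
    using c by (auto simp: B_def m_def bij_betw_def intro!: bounded_subset[OF bnd])
  moreover have "(\<Sum>i<m. c i * indicator (B i) x) = g x" for x
  proof (cases "g x = 0")
    case True
    then show ?thesis using c by (auto simp: B_def m_def bij_betw_def indicator_def intro!: sum.neutral)
  next
    case False
    then have "g x \<in> c ` {..<m}"
      using bij_betw_imp_surj_on[OF c] by (simp add: m_def)
    then obtain j where j: "j < m" "c j = g x"
      by auto
    have "x \<in> B i \<longleftrightarrow> i = j" if "i < m" for i
    proof -
      have "i = j" if "c i = c j"
        using inj_onD[OF bij_betw_imp_inj_on[OF c] that] \<open>i < m\<close> j by (simp add: m_def)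
      moreover have "x \<in> B i \<longleftrightarrow> c i = c j"
        unfolding B_def j(2) using that by auto
      ultimately show ?thesis by blast
    qed
    then have "(\<Sum>i<m. c i * indicator (B i) x) = (\<Sum>i<m. if i = j then c j else 0)"
      by (intro sum.cong) auto
    then show ?thesis
      using j by simp
  qed
  ultimately show ?thesis
    using poisson_laplace_simple[of B c m] by presburger
qed

lemma poisson_laplace:
  assumes f [measurable]: "f \<in> borel_measurable borel"
  shows "(\<integral>\<^sup>+\<omega>. ennreal (exp_neg (\<Sum>n. f (X n \<omega>))) \<partial>M) =
    ennreal (exp_neg (ennreal \<rho> * (\<integral>\<^sup>+x. ennreal (1 - exp_neg (f x)) \<partial>lborel)))"
proof -
  note [measurable] = measurable_poisson
  obtain F where F: "\<And>i. simple_function borel (F i)" "incseq F" "\<And>x. (SUP i. F i x) = f x"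
    using borel_measurable_implies_simple_function_sequence'[OF f] by metis
  define G where "G k x = F k x * indicator (ball 0 (real k)) x" for k x
  have G_simple: "simple_function borel (G k)" for k
    unfolding G_def by (intro simple_function_mult F simple_function_indicator) auto
  note [measurable] = borel_measurable_simple_function[OF G_simple]
  have G_bnd: "bounded {x. G k x \<noteq> 0}" for k
    by (rule bounded_subset[OF bounded_ball[of 0 "real k"]]) (auto simp: G_def indicator_def)
  have G_mono: "incseq (\<lambda>k. G k x)" for x
    unfolding G_def using F(2)
    by (intro monoI mult_mono) (auto simp: incseq_def le_fun_def indicator_def)
  have G_lim: "(\<lambda>k. G k x) \<longlonglongrightarrow> f x" for x
  proof -
    have "(\<lambda>k. F k x) \<longlonglongrightarrow> f x"
      using LIMSEQ_SUP[of "\<lambda>k. F k x"] F by (simp add: incseq_def le_fun_def)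
    moreover have "eventually (\<lambda>k. F k x = G k x) sequentially"
      using eventually_gt_at_top[of "nat \<lceil>norm x\<rceil>"]
    proof eventually_elim
      case (elim k)
      then have "norm x < real k" by linarith
      then show ?case by (simp add: G_def)
    qed
    ultimately show ?thesis
      by (rule Lim_transform_eventually)
  qed
  have G_sup: "(SUP k. G k x) = f x" for x
    using LIMSEQ_unique[OF LIMSEQ_SUP[OF G_mono] G_lim] .
  have "(\<lambda>k. \<integral>\<^sup>+\<omega>. ennreal (exp_neg (\<Sum>n. G k (X n \<omega>))) \<partial>M) \<longlonglongrightarrow>
      (\<integral>\<^sup>+\<omega>. ennreal (exp_neg (\<Sum>n. f (X n \<omega>))) \<partial>M)"
  proof (rule nn_integral_dominated_convergence[where w = "\<lambda>_. 1"])
    have "(\<lambda>k. \<Sum>n. G k (X n \<omega>)) \<longlonglongrightarrow> (\<Sum>n. f (X n \<omega>))" for \<omega>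
    proof -
      have "incseq (\<lambda>k. \<Sum>n. G k (X n \<omega>))"
        using G_mono by (intro monoI suminf_le) (auto simp: incseq_def)
      from LIMSEQ_SUP[OF this] show ?thesis
        using G_mono by (subst (asm) ennreal_suminf_SUP_eq[symmetric]) (auto simp: G_sup)
    qed
    then show "AE \<omega> in M. (\<lambda>k. ennreal (exp_neg (\<Sum>n. G k (X n \<omega>)))) \<longlonglongrightarrow> ennreal (exp_neg (\<Sum>n. f (X n \<omega>)))"
      by (intro AE_I2 tendsto_ennrealI tendsto_exp_neg)
  qed (auto simp: emeasure_space_1)
  moreover have "(\<lambda>k. ennreal (exp_neg (ennreal \<rho> * (\<integral>\<^sup>+x. ennreal (1 - exp_neg (G k x)) \<partial>lborel)))) \<longlonglongrightarrow>
      ennreal (exp_neg (ennreal \<rho> * (\<integral>\<^sup>+x. ennreal (1 - exp_neg (f x)) \<partial>lborel)))"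
  proof (intro tendsto_ennrealI tendsto_exp_neg ennreal_tendsto_cmult nn_integral_LIMSEQ)
    show "incseq (\<lambda>k x. ennreal (1 - exp_neg (G k x)))"
      using G_mono by (auto simp: incseq_def le_fun_def intro!: ennreal_leI exp_neg_antimono)
    show "(\<lambda>k. 1 - exp_neg (G k x)) \<longlonglongrightarrow> 1 - exp_neg (f x)" for x
      by (intro tendsto_intros tendsto_exp_neg G_lim)
  qed auto
  ultimately show ?thesis
    unfolding poisson_laplace_simple_function[OF G_simple G_bnd] by (rule LIMSEQ_unique)
qed

end

end

subsection \<open>Radial integrals in the plane\<close>

lemma distr_dist_plane:
  fixes y :: plane
  shows "distr lborel borel (\<lambda>x. dist x y) = density lborel (\<lambda>r. ennreal (2 * pi * r))"
proof (rule measure_eqI_generator_eq[where E = "range (\<lambda>a. {..a})" and \<Omega> = UNIV and A = "\<lambda>n. {..real n}"])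
  have disc: "emeasure (distr lborel borel (\<lambda>x. dist x y)) {..a} = ennreal (if 0 \<le> a then pi * a\<^sup>2 else 0)" for a
  proof -
    have "emeasure (distr lborel borel (\<lambda>x. dist x y)) {..a} = emeasure lborel (cball y a)"
      by (subst emeasure_distr) (auto intro!: arg_cong[of _ _ "emeasure lborel"] simp: dist_commute)
    then show ?thesis
      by (simp add: emeasure_cball eval_unit_ball_vol)
  qed
  show "emeasure (distr lborel borel (\<lambda>x. dist x y)) {..real n} \<noteq> \<infinity>" for n
    unfolding disc by simp
  fix D assume "D \<in> range (\<lambda>a::real. {..a})"
  then obtain a where D: "D = {..a}" by auto
  have "emeasure (density lborel (\<lambda>r. ennreal (2 * pi * r))) {..a} =
      (\<integral>\<^sup>+r. ennreal (2 * pi * r) * indicator {0..a} r \<partial>lborel)"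
    by (subst emeasure_density) (auto intro!: nn_integral_cong simp: indicator_def ennreal_neg mult_nonneg_nonpos)
  also have "\<dots> = ennreal (if 0 \<le> a then pi * a\<^sup>2 else 0)"
  proof (cases "0 \<le> a")
    case True
    then have "(\<integral>\<^sup>+r. ennreal (2 * pi * r) * indicator {0..a} r \<partial>lborel) = ennreal (pi * a\<^sup>2 - pi * 0\<^sup>2)"
      by (intro nn_integral_FTC_Icc) (auto intro!: derivative_eq_intros)
    with True show ?thesis by simp
  qed simp
  finally show "emeasure (distr lborel borel (\<lambda>x. dist x y)) D = emeasure (density lborel (\<lambda>r. ennreal (2 * pi * r))) D"
    unfolding D disc by simp
qed (auto simp: Int_stable_def borel_eq_atMost intro: real_arch_simple)

lemma nn_integral_dist_plane:
  fixes y :: plane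
  assumes [measurable]: "f \<in> borel_measurable borel"
  shows "(\<integral>\<^sup>+x. f (dist x y) \<partial>lborel) = (\<integral>\<^sup>+r. ennreal (2 * pi * r) * f r \<partial>lborel)"
proof -
  have "(\<integral>\<^sup>+x. f (dist x y) \<partial>lborel) = (\<integral>\<^sup>+r. f r \<partial>distr lborel borel (\<lambda>x. dist x y))"
    by (subst nn_integral_distr) auto
  then show ?thesis
    by (simp add: distr_dist_plane nn_integral_density)
qed

lemma nn_integral_beta_powr:
  fixes a \<alpha> :: real
  assumes a: "0 < a" and \<alpha>: "2 < \<alpha>" and k: "1 \<le> k" "k \<le> S"
  shows "(\<integral>\<^sup>+r. indicator {0<..} r * ennreal (r * (a * r powr - \<alpha>) ^ k / (1 + a * r powr - \<alpha>) ^ S) \<partial>lborel) =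
    ennreal (a powr (2 / \<alpha>) * (Gamma (- real k + 2 / \<alpha> + real S) * Gamma (real k - 2 / \<alpha>) / (\<alpha> * Gamma (real S))))"
proof -
  define p where "p = 2 / \<alpha>"
  have p: "0 < p" "p < 1" using \<alpha> by (auto simp: p_def)
  define c where "c = real S - real k + p"
  define d where "d = real k - p"
  have cd: "0 < c" "0 < d" using k p by (auto simp: c_def d_def)
  define g where "g r = r powr \<alpha> / (r powr \<alpha> + a)" for r
  define g' where "g' r = \<alpha> * r powr (\<alpha> - 1) * a / (r powr \<alpha> + a)\<^sup>2" for r
  define f where "f t = a powr p / \<alpha> * (t powr (c - 1) * (1 - t) powr (d - 1))" for t
  have der: "(g has_field_derivative g' r) (at r within {0<..})" if "r \<in> {0<..}" for r
  proof -
    have "r powr \<alpha> + a \<noteq> 0" using a by (smt (verit) powr_ge_zero)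
    then show ?thesis unfolding g_def g'_def using that
      by (auto intro!: derivative_eq_intros simp: field_simps power2_eq_square)
  qed
  have inj: "inj_on g {0<..}"
  proof (rule inj_onI)
    fix r s assume rs: "r \<in> {0<..}" "s \<in> {0<..}" "g r = g s"
    have "r powr \<alpha> + a > 0" "s powr \<alpha> + a > 0" using a by (smt (verit) powr_ge_zero)+
    then have "r powr \<alpha> = s powr \<alpha>" using rs(3) a by (auto simp: g_def field_simps)
    then have "(r powr \<alpha>) powr (1 / \<alpha>) = (s powr \<alpha>) powr (1 / \<alpha>)" by simp
    then show "r = s" using rs \<alpha> by (simp add: powr_powr)
  qed
  have img: "g ` {0<..} = {0<..<1}"
  proof safe
    fix r :: real assume "0 < r"
    define q where "q = r powr \<alpha>"
    have "0 < q" using \<open>0 < r\<close> by (simp add: q_def)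
    then show "g r \<in> {0<..<1}" using a by (auto simp: g_def q_def[symmetric] field_simps)
  next
    fix t :: real assume t: "t \<in> {0<..<1}"
    define r where "r = (a * t / (1 - t)) powr (1 / \<alpha>)"
    have "r powr \<alpha> = a * t / (1 - t)" using t a \<alpha> by (simp add: r_def powr_powr)
    moreover have "a * t / (1 - t) + a = a / (1 - t)" using t by (simp add: field_simps)
    ultimately have "g r = t" using t a by (simp add: g_def)
    moreover have "0 < r" using t a by (simp add: r_def)
    ultimately show "t \<in> g ` {0<..}" by auto
  qed
  have "(f has_integral a powr p / \<alpha> * Beta c d) {0<..<1}"
    unfolding f_def using has_integral_Beta_real[OF cd]
    by (intro has_integral_mult_right) (simp add: has_integral_Icc_iff_Ioo)
  moreover from this have "f absolutely_integrable_on {0<..<1}"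
    using \<alpha> by (intro nonnegative_absolutely_integrable_1) (auto simp: f_def integrable_on_def)
  ultimately have "(\<lambda>r. \<bar>g' r\<bar> * f (g r)) absolutely_integrable_on {0<..} \<and>
      integral {0<..} (\<lambda>r. \<bar>g' r\<bar> * f (g r)) = a powr p / \<alpha> * Beta c d"
    using has_absolute_integral_change_of_variables_1'[OF _ der inj, of f "a powr p / \<alpha> * Beta c d"]
    unfolding img by (auto simp: integral_unique)
  then have int: "((\<lambda>r. \<bar>g' r\<bar> * f (g r)) has_integral a powr p / \<alpha> * Beta c d) {0<..}"
    using set_lebesgue_integral_eq_integral(1) integrable_integral by metis
  have eq: "\<bar>g' r\<bar> * f (g r) = r * (a * r powr - \<alpha>) ^ k / (1 + a * r powr - \<alpha>) ^ S" if "0 < r" for r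
  proof -
    define q where "q = r powr \<alpha>"
    define w where "w = q + a"
    have pos: "0 < q" "0 < w" using that a by (auto simp: q_def w_def add_pos_pos)
    have g: "g r = q / w" "1 - g r = a / w" using pos by (auto simp: g_def q_def[symmetric] w_def field_simps)
    have g': "g' r = \<alpha> * (q / r) * a / w\<^sup>2"
      using that by (simp add: g'_def q_def w_def powr_diff)
    have qp: "q powr p = r\<^sup>2"
      using that \<alpha> by (simp add: q_def p_def powr_powr flip: powr_numeral)
    have "q powr (c - 1) = q powr real S * q powr p / (q powr real k * q)"
      using pos unfolding c_def by (simp add: powr_add powr_diff)
    then have q1: "q powr (c - 1) = q ^ S * r\<^sup>2 / (q ^ k * q)"
      using pos by (simp add: powr_realpow qp)
    have a1: "a powr (d - 1) = a ^ k / (a powr p * a)"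
      using a unfolding d_def by (simp add: powr_diff powr_realpow)
    have "w powr (c - 1) * w powr (d - 1) = w powr (real S - 2)"
      by (simp add: powr_add[symmetric] c_def d_def)
    also have "\<dots> = w ^ S / w\<^sup>2"
      using pos by (simp add: powr_diff powr_realpow)
    finally have w1: "w powr (c - 1) * w powr (d - 1) = w ^ S / w\<^sup>2" .
    have "(q / w) powr (c - 1) * (a / w) powr (d - 1) = q powr (c - 1) * a powr (d - 1) / (w powr (c - 1) * w powr (d - 1))"
      using pos a by (simp add: powr_divide)
    then have qw: "(q / w) powr (c - 1) * (a / w) powr (d - 1) =
       (q ^ S * r\<^sup>2 / (q ^ k * q)) * (a ^ k / (a powr p * a)) / (w ^ S / w\<^sup>2)"
      unfolding q1 a1 w1 .
    have abs_g': "\<bar>g' r\<bar> = \<alpha> * (q / r) * a / w\<^sup>2"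
      using pos a \<alpha> that unfolding g' by (intro abs_of_nonneg) simp
    have "\<bar>g' r\<bar> * f (g r) = \<alpha> * (q / r) * a / w\<^sup>2 * (a powr p / \<alpha> *
       ((q ^ S * r\<^sup>2 / (q ^ k * q)) * (a ^ k / (a powr p * a)) / (w ^ S / w\<^sup>2)))"
      unfolding f_def g(2) unfolding g(1) qw abs_g' ..
    also have "\<dots> = r * a ^ k * (q ^ S / q ^ k) / w ^ S"
      using pos a \<alpha> that by (simp add: field_simps power2_eq_square)
    also have "a * r powr - \<alpha> = a / q" "1 + a * r powr - \<alpha> = w / q"
      using pos by (auto simp: q_def[symmetric] w_def powr_minus field_simps)
    then have "r * a ^ k * (q ^ S / q ^ k) / w ^ S = r * (a * r powr - \<alpha>) ^ k / (1 + a * r powr - \<alpha>) ^ S"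
      by (simp add: power_divide)
    finally show ?thesis .
  qed
  have "((\<lambda>r. r * (a * r powr - \<alpha>) ^ k / (1 + a * r powr - \<alpha>) ^ S) has_integral a powr p / \<alpha> * Beta c d) {0<..}"
    using int by (rule has_integral_eq[rotated]) (simp add: eq)
  then have "(\<integral>\<^sup>+r. ennreal (r * (a * r powr - \<alpha>) ^ k / (1 + a * r powr - \<alpha>) ^ S) * indicator {0<..} r \<partial>lborel) =
      ennreal (a powr p / \<alpha> * Beta c d)"
    using a by (intro nn_integral_has_integral_lebesgue') auto
  also have "a powr p / \<alpha> * Beta c d = a powr (2 / \<alpha>) * (Gamma (- real k + 2 / \<alpha> + real S) * Gamma (real k - 2 / \<alpha>) / (\<alpha> * Gamma (real S)))"
    by (simp add: Beta_def c_def d_def p_def algebra_simps)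
  finally show ?thesis
    by (simp only: mult.commute)
qed

lemma Gamma_factors_nonneg:
  fixes \<alpha> :: real
  assumes "2 < \<alpha>" "1 \<le> k" "k \<le> S"
  shows "0 \<le> Gamma (- real k + 2 / \<alpha> + real S) * Gamma (real k - 2 / \<alpha>) / (\<alpha> * Gamma (real S))"
proof -
  have "2 / \<alpha> < 1" "0 < 2 / \<alpha>" using assms by auto
  moreover have "1 \<le> real k" "real k \<le> real S" using assms by auto
  ultimately have "0 < - real k + 2 / \<alpha> + real S" "0 < real k - 2 / \<alpha>" "0 < real S" by linarith+
  then show ?thesis
    using assms by (auto intro!: mult_nonneg_nonneg divide_nonneg_nonneg less_imp_le[OF Gamma_real_pos])
qed

definition interference_const :: "nat \<Rightarrow> real \<Rightarrow> real" where
  "interference_const S \<alpha> = (\<Sum>k=1..S. real (S choose k) *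
     (Gamma (- real k + 2 / \<alpha> + real S) * Gamma (real k - 2 / \<alpha>) / (\<alpha> * Gamma (real S))))"

lemma interference_const_nonneg:
  assumes "2 < \<alpha>"
  shows "0 \<le> interference_const S \<alpha>"
  unfolding interference_const_def
  using Gamma_factors_nonneg[OF assms] by (intro sum_nonneg mult_nonneg_nonneg) auto

lemma one_minus_inverse_power:
  fixes u :: real
  assumes "0 \<le> u"
  shows "1 - 1 / (1 + u) ^ S = (\<Sum>k=1..S. real (S choose k) * (u ^ k / (1 + u) ^ S))"
proof -
  have "(1 + u) ^ S = (\<Sum>k\<le>S. real (S choose k) * u ^ k)"
    using binomial_ring[of u 1 S] by (simp add: add.commute)
  also have "\<dots> = 1 + (\<Sum>k=1..S. real (S choose k) * u ^ k)"
    by (simp add: atMost_atLeast0 sum.atLeast_Suc_atMost)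
  finally have "(\<Sum>k=1..S. real (S choose k) * u ^ k) = (1 + u) ^ S - 1" by simp
  moreover have "1 + u \<noteq> 0" using assms by simp
  ultimately show ?thesis
    by (simp add: sum_divide_distrib[symmetric] diff_divide_distrib)
qed

lemma nn_integral_interference:
  fixes y :: plane
  assumes a: "0 \<le> a" and \<alpha>: "2 < \<alpha>"
  shows "(\<integral>\<^sup>+x. ennreal (1 - exp_neg (ennreal (real S * ln (1 + a * dist x y powr - \<alpha>)))) \<partial>lborel) =
    ennreal (2 * pi * (a powr (2 / \<alpha>) * interference_const S \<alpha>))"
proof (cases "a = 0")
  case False
  with a have a: "0 < a" by simp
  have eq: "1 - exp_neg (ennreal (real S * ln (1 + a * r powr - \<alpha>))) =
     (\<Sum>k=1..S. real (S choose k) * ((a * r powr - \<alpha>) ^ k / (1 + a * r powr - \<alpha>) ^ S))" for r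
  proof -
    have u: "0 \<le> a * r powr - \<alpha>" using a by simp
    then have "exp_neg (ennreal (real S * ln (1 + a * r powr - \<alpha>))) = exp (- (real S * ln (1 + a * r powr - \<alpha>)))"
      by (intro exp_neg_ennreal mult_nonneg_nonneg) auto
    also have "\<dots> = 1 / (1 + a * r powr - \<alpha>) ^ S"
      using u by (simp add: exp_minus exp_of_nat_mult inverse_eq_divide)
    finally show ?thesis
      using one_minus_inverse_power[OF u] by simp
  qed
  define G where "G k = a powr (2 / \<alpha>) * (Gamma (- real k + 2 / \<alpha> + real S) * Gamma (real k - 2 / \<alpha>) / (\<alpha> * Gamma (real S)))" for k
  have "(\<integral>\<^sup>+x. ennreal (1 - exp_neg (ennreal (real S * ln (1 + a * dist x y powr - \<alpha>)))) \<partial>lborel) =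
      (\<integral>\<^sup>+r. ennreal (2 * pi * r) * ennreal (1 - exp_neg (ennreal (real S * ln (1 + a * r powr - \<alpha>)))) \<partial>lborel)"
    by (rule nn_integral_dist_plane) measurable
  also have "\<dots> = (\<integral>\<^sup>+r. (\<Sum>k=1..S. ennreal (2 * pi * real (S choose k)) *
      (indicator {0<..} r * ennreal (r * (a * r powr - \<alpha>) ^ k / (1 + a * r powr - \<alpha>) ^ S))) \<partial>lborel)"
  proof (rule nn_integral_cong)
    fix r
    show "ennreal (2 * pi * r) * ennreal (1 - exp_neg (ennreal (real S * ln (1 + a * r powr - \<alpha>)))) =
      (\<Sum>k=1..S. ennreal (2 * pi * real (S choose k)) *
      (indicator {0<..} r * ennreal (r * (a * r powr - \<alpha>) ^ k / (1 + a * r powr - \<alpha>) ^ S)))"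
    proof (cases "0 < r")
      case True
      then show ?thesis
        using a unfolding eq
        by (simp add: ennreal_mult'[symmetric] sum_ennreal sum_nonneg sum_distrib_left ac_simps)
    next
      case False
      then have "2 * pi * r \<le> 0" by (simp add: mult_nonneg_nonpos)
      then show ?thesis using False by (simp add: ennreal_neg)
    qed
  qed
  also have "\<dots> = (\<Sum>k=1..S. ennreal (2 * pi * real (S choose k)) * ennreal (G k))"
    unfolding G_def using nn_integral_beta_powr[OF a \<alpha>]
    by (subst nn_integral_sum, measurable) (auto simp: nn_integral_cmult intro!: sum.cong)
  also have "\<dots> = ennreal (\<Sum>k=1..S. 2 * pi * real (S choose k) * G k)"
  proof -
    have "0 \<le> G k" if "k \<in> {1..S}" for k
      unfolding G_def using that Gamma_factors_nonneg[OF \<alpha>] by (intro mult_nonneg_nonneg) auto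
    then show ?thesis
      by (subst sum_ennreal[symmetric]) (auto simp: ennreal_mult')
  qed
  also have "(\<Sum>k=1..S. 2 * pi * real (S choose k) * G k) = 2 * pi * (a powr (2 / \<alpha>) * interference_const S \<alpha>)"
    unfolding interference_const_def G_def sum_distrib_left by (intro sum.cong) auto
  finally show ?thesis .
qed simp

lemma interference_const_1:
  assumes "2 < \<alpha>"
  shows "interference_const 1 \<alpha> = pi / (\<alpha> * sin (2 * pi / \<alpha>))"
proof -
  have "complex_of_real (Gamma (2 / \<alpha>) * Gamma (1 - 2 / \<alpha>)) = complex_of_real (pi / sin (pi * (2 / \<alpha>)))"
    using Gamma_reflection_complex[of "complex_of_real (2 / \<alpha>)"]
    by (simp add: Gamma_complex_of_real[symmetric] sin_of_real[symmetric])
  then have "Gamma (2 / \<alpha>) * Gamma (1 - 2 / \<alpha>) = pi / sin (pi * (2 / \<alpha>))"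
    using of_real_eq_iff by blast
  then show ?thesis
    by (simp add: interference_const_def mult.commute)
qed

subsection \<open>Gamma-distributed gains\<close>

context prob_space
begin

lemma nn_integral_exp_neg_erlang:
  assumes D: "distributed M lborel G (\<lambda>x. ennreal (erlang_density k 1 x))" and a: "0 \<le> a"
  shows "(\<integral>\<^sup>+\<omega>. ennreal (exp_neg (ennreal a * ennreal (G \<omega>))) \<partial>M) =
    ennreal (exp_neg (ennreal (real (Suc k) * ln (1 + a))))"
proof -
  have "(\<integral>\<^sup>+\<omega>. ennreal (exp_neg (ennreal a * ennreal (G \<omega>))) \<partial>M) =
      (\<integral>\<^sup>+x. ennreal (erlang_density k 1 x) * ennreal (exp_neg (ennreal a * ennreal x)) \<partial>lborel)"
    by (rule distributed_nn_integral[OF D, symmetric]) measurable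
  also have "\<dots> = (\<integral>\<^sup>+x. ennreal (1 / (1 + a) ^ Suc k) * ennreal (erlang_density k (1 + a) x) \<partial>lborel)"
  proof (rule nn_integral_cong)
    fix x :: real
    show "ennreal (erlang_density k 1 x) * ennreal (exp_neg (ennreal a * ennreal x)) =
        ennreal (1 / (1 + a) ^ Suc k) * ennreal (erlang_density k (1 + a) x)"
    proof (cases "x < 0")
      case False
      have "erlang_density k 1 x * exp (- (a * x)) = x ^ k * (exp (- x) * exp (- (a * x))) / fact k"
        using False by (simp add: erlang_density_def)
      also have "exp (- x) * exp (- (a * x)) = exp (- (1 + a) * x)"
        by (simp add: exp_add[symmetric] algebra_simps)
      also have "x ^ k * exp (- (1 + a) * x) / fact k = 1 / (1 + a) ^ Suc k * erlang_density k (1 + a) x"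
        using False a by (simp add: erlang_density_def)
      finally show ?thesis
        using a False by (simp add: exp_neg_ennreal ennreal_mult[symmetric])
    qed (simp add: erlang_density_def)
  qed
  also have "\<dots> = ennreal (1 / (1 + a) ^ Suc k)"
  proof -
    interpret E: prob_space "density lborel (erlang_density k (1 + a))"
      using a by (intro prob_space_erlang_density) simp
    have "(\<integral>\<^sup>+x. ennreal (erlang_density k (1 + a) x) \<partial>lborel) = 1"
      using E.emeasure_space_1 by (simp add: emeasure_density)
    then show ?thesis by (simp add: nn_integral_cmult)
  qed
  also have "1 / (1 + a) ^ Suc k = exp (- (real (Suc k) * ln (1 + a)))"
    using a by (simp only: exp_minus exp_of_nat_mult) (simp add: inverse_eq_divide)
  finally show ?thesis
    using a by (subst exp_neg_ennreal) auto
qed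

lemma nn_integral_exp_neg_suminf_erlang:
  assumes ind: "indep_vars (\<lambda>_. borel) g UNIV" and l: "inj l"
    and D: "\<And>n. distributed M lborel (g (l n)) (\<lambda>x. ennreal (erlang_density k 1 x))"
    and a: "\<And>n::nat. 0 \<le> a n"
  shows "(\<integral>\<^sup>+\<omega>. ennreal (exp_neg (\<Sum>n. ennreal (a n) * ennreal (g (l n) \<omega>))) \<partial>M) =
    ennreal (exp_neg (\<Sum>n. ennreal (real (Suc k) * ln (1 + a n))))"
proof -
  have [measurable]: "g i \<in> borel_measurable M" for i
    using ind by (auto simp: indep_vars_def)
  have eq: "(\<integral>\<^sup>+\<omega>. (\<Prod>n<N. ennreal (exp_neg (ennreal (a n) * ennreal (g (l n) \<omega>)))) \<partial>M) =
      (\<Prod>n<N. ennreal (exp_neg (ennreal (real (Suc k) * ln (1 + a n)))))" for N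
  proof -
    have "(\<integral>\<^sup>+\<omega>. (\<Prod>n<N. ennreal (exp_neg (ennreal (a n) * ennreal (g (l n) \<omega>)))) \<partial>M) =
        (\<Prod>n<N. \<integral>\<^sup>+\<omega>. ennreal (exp_neg (ennreal (a n) * ennreal (g (l n) \<omega>))) \<partial>M)"
      using l by (intro nn_integral_prod_blocks[OF ind, where J = "\<lambda>n. {l n}"
          and F = "\<lambda>n u. ennreal (exp_neg (ennreal (a n) * ennreal (u (l n))))"])
        (auto simp: depends_only_def disjoint_family_on_def inj_def)
    then show ?thesis
      by (simp add: nn_integral_exp_neg_erlang[OF D a])
  qed
  have "(\<lambda>N. \<integral>\<^sup>+\<omega>. (\<Prod>n<N. ennreal (exp_neg (ennreal (a n) * ennreal (g (l n) \<omega>)))) \<partial>M) \<longlonglongrightarrow>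
     (\<integral>\<^sup>+\<omega>. ennreal (exp_neg (\<Sum>n. ennreal (a n) * ennreal (g (l n) \<omega>))) \<partial>M)"
    by (rule nn_integral_dominated_convergence[where w = "\<lambda>_. 1"])
      (auto simp: emeasure_space_1 prod_ennreal intro!: prod_le_1 tendsto_ennrealI exp_neg_suminf)
  moreover have "(\<lambda>N. \<Prod>n<N. ennreal (exp_neg (ennreal (real (Suc k) * ln (1 + a n))))) \<longlonglongrightarrow>
      ennreal (exp_neg (\<Sum>n. ennreal (real (Suc k) * ln (1 + a n))))"
    by (auto simp: prod_ennreal intro!: tendsto_ennrealI exp_neg_suminf)
  ultimately show ?thesis
    unfolding eq by (rule LIMSEQ_unique)
qed

lemma AE_erlang_nonneg:
  assumes D: "distributed M lborel G (\<lambda>x. ennreal (erlang_density k 1 x))"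
  shows "AE \<omega> in M. 0 \<le> G \<omega>"
  by (subst distributed_AE2[OF D]) (auto simp: erlang_density_def)

lemma nn_integral_exponential_le:
  assumes D: "distributed M lborel G (\<lambda>x. ennreal (exponential_density 1 x))"
  shows "(\<integral>\<^sup>+\<omega>. indicator {\<omega>. ennreal (G \<omega>) \<le> T} \<omega> \<partial>M) = ennreal (1 - exp_neg T)"
proof (cases T)
  case (real t)
  have [measurable]: "G \<in> borel_measurable M"
    using distributed_measurable[OF D] by simp
  have "(\<integral>\<^sup>+\<omega>. indicator {\<omega>. ennreal (G \<omega>) \<le> T} \<omega> \<partial>M) = (\<integral>\<^sup>+\<omega>. indicator {\<omega>\<in>space M. G \<omega> \<le> t} \<omega> \<partial>M)"
    using real by (intro nn_integral_cong) (auto simp: indicator_def)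
  also have "\<dots> = ennreal (1 - exp (- t * 1))"
    using exponential_distributedD_le[OF D, of t] real by (simp add: emeasure_eq_measure)
  finally show ?thesis
    using real by (simp add: exp_neg_ennreal)
qed (simp add: emeasure_space_1)

lemma nn_integral_one_minus:
  assumes [measurable]: "f \<in> borel_measurable M" and f: "\<And>\<omega>. 0 \<le> f \<omega>" "\<And>\<omega>. f \<omega> \<le> 1"
    and c: "(\<integral>\<^sup>+\<omega>. ennreal (f \<omega>) \<partial>M) = ennreal c" "0 \<le> c"
  shows "(\<integral>\<^sup>+\<omega>. ennreal (1 - f \<omega>) \<partial>M) = ennreal (1 - c)"
proof -
  have "(\<integral>\<^sup>+\<omega>. ennreal (1 - f \<omega>) \<partial>M) = (\<integral>\<^sup>+\<omega>. 1 - ennreal (f \<omega>) \<partial>M)"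
    using f by (simp add: ennreal_minus[symmetric])
  also have "\<dots> = 1 - ennreal c"
    using f c by (subst nn_integral_diff) (auto simp: emeasure_space_1)
  finally show ?thesis
    using c by (simp add: ennreal_minus[symmetric])
qed

lemma AE_eq_1_if_nn_integral_eq_1:
  assumes [measurable]: "f \<in> borel_measurable M" and f: "\<And>\<omega>. 0 \<le> f \<omega>" "\<And>\<omega>. f \<omega> \<le> 1"
    and 1: "(\<integral>\<^sup>+\<omega>. ennreal (f \<omega>) \<partial>M) = 1"
  shows "AE \<omega> in M. f \<omega> = 1"
proof -
  have "(\<integral>\<^sup>+\<omega>. ennreal (1 - f \<omega>) \<partial>M) = 0"
    using nn_integral_one_minus[of f 1] f 1 by simp
  then have "AE \<omega> in M. ennreal (1 - f \<omega>) = 0"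
    by (subst (asm) nn_integral_0_iff_AE) auto
  then show ?thesis
    using f by (auto simp: ennreal_eq_0_iff elim!: eventually_mono intro: antisym)
qed

end

subsection \<open>Interference at an eavesdropper\<close>

abbreviation positions :: "(process \<Rightarrow> nat \<Rightarrow> plane) measure" where
  "positions \<equiv> PiM UNIV (\<lambda>_. PiM UNIV (\<lambda>_. borel))"

abbreviation gains :: "(link \<Rightarrow> real) measure" where
  "gains \<equiv> PiM UNIV (\<lambda>_. borel)"

lemma measurable_position: "(\<lambda>x. x p n) \<in> borel_measurable positions"
proof -
  have "(\<lambda>x. x p) \<in> measurable positions (PiM UNIV (\<lambda>_. borel))"
    by (rule measurable_component_singleton) simp
  then show ?thesis
    by (rule measurable_compose[OF _ measurable_component_singleton]) simp
qed

lemma space_positions [simp]: "space positions = UNIV"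
  by (simp add: space_PiM)

lemma space_gains [simp]: "space gains = UNIV"
  by (simp add: space_PiM)

definition all_pos :: "'a hetnet \<Rightarrow> 'a \<Rightarrow> process \<Rightarrow> nat \<Rightarrow> plane" where
  "all_pos H \<omega> = (\<lambda>p n. pos H p n \<omega>)"

definition all_gains :: "'a hetnet \<Rightarrow> 'a \<Rightarrow> link \<Rightarrow> real" where
  "all_gains H \<omega> = (\<lambda>l. gain H l \<omega>)"

text \<open>
  \<open>s\<close> times interference plus noise at eavesdropper \<open>e\<close> located at \<open>y\<close>, as an extended real so that
  divergent series need no separate treatment; \<open>mean_load\<close> arises from it by averaging \<open>exp_neg\<close> over the
  gains, and \<open>total_load\<close> from that by averaging over the interferer positions.
\<close>

definition load :: "'a hetnet \<Rightarrow> nat \<Rightarrow> real \<Rightarrow> (process \<Rightarrow> nat \<Rightarrow> plane) \<Rightarrow> (link \<Rightarrow> real) \<Rightarrow> plane \<Rightarrow> ennreal" where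
  "load H e s x g y =
     (\<Sum>n. ennreal (s * pow_M H / real (users H) * beta H * dist (x (MBS (Eve e)) n) y powr - alpha1 H) *
           ennreal (g (From_MBS (Eve e) n))) +
     (\<Sum>n. ennreal (s * pow_P H * beta H * dist (x (PBS (Eve e)) n) y powr - alpha2 H) *
           ennreal (g (From_PBS (Eve e) n))) +
     ennreal (s * (delta H)\<^sup>2)"

definition mean_load :: "'a hetnet \<Rightarrow> nat \<Rightarrow> real \<Rightarrow> (process \<Rightarrow> nat \<Rightarrow> plane) \<Rightarrow> plane \<Rightarrow> ennreal" where
  "mean_load H e s x y =
     (\<Sum>n. ennreal (real (users H) *
        ln (1 + s * pow_M H / real (users H) * beta H * dist (x (MBS (Eve e)) n) y powr - alpha1 H))) +
     (\<Sum>n. ennreal (real 1 * ln (1 + s * pow_P H * beta H * dist (x (PBS (Eve e)) n) y powr - alpha2 H))) +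
     ennreal (s * (delta H)\<^sup>2)"

definition total_load :: "'a hetnet \<Rightarrow> real \<Rightarrow> real" where
  "total_load H s =
     dens_M H * (2 * pi * ((s * pow_M H / real (users H) * beta H) powr (2 / alpha1 H) * interference_const (users H) (alpha1 H))) +
     dens_P H * (2 * pi * ((s * pow_P H * beta H) powr (2 / alpha2 H) * interference_const 1 (alpha2 H))) +
     s * (delta H)\<^sup>2"

definition sinr_scale :: "'a hetnet \<Rightarrow> real \<Rightarrow> real \<Rightarrow> real" where
  "sinr_scale H \<gamma> r = \<gamma> * r powr alpha2 H / (beta H * pow_P H)"

lemma measurable_load:
  assumes [measurable]: "s \<in> borel_measurable N" "y \<in> borel_measurable N"
    and x: "x \<in> measurable N positions" and g: "g \<in> measurable N gains"
  shows "(\<lambda>w. load H e (s w) (x w) (g w) (y w)) \<in> borel_measurable N"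
proof -
  have [measurable]: "(\<lambda>w. x w p n) \<in> borel_measurable N" for p n
    by (rule measurable_compose[OF x measurable_position])
  have [measurable]: "(\<lambda>w. g w l) \<in> borel_measurable N" for l
    by (rule measurable_compose[OF g]) measurable
  show ?thesis
    unfolding load_def by measurable
qed

lemma measurable_load_gains: "(\<lambda>g. load H e s x g y) \<in> borel_measurable gains"
  by (rule measurable_load[OF measurable_const measurable_const measurable_const measurable_ident_sets]) simp_all

lemma sets_gain_le_load: "{g. ennreal (g (Target e)) \<le> load H e s x g y} \<in> sets gains"
proof -
  note [measurable] = measurable_load_gains[of H e s x y]
  have "{g \<in> space gains. ennreal (g (Target e)) \<le> load H e s x g y} \<in> sets gains"
    by measurable
  then show ?thesis by simp
qed

lemma measurable_mean_load:
  assumes [measurable]: "s \<in> borel_measurable N" "y \<in> borel_measurable N"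
    and x: "x \<in> measurable N positions"
  shows "(\<lambda>w. mean_load H e (s w) (x w) (y w)) \<in> borel_measurable N"
proof -
  have [measurable]: "(\<lambda>w. x w p n) \<in> borel_measurable N" for p n
    by (rule measurable_compose[OF x measurable_position])
  show ?thesis
    unfolding mean_load_def by measurable
qed

lemma depends_only_load:
  "depends_only (range (From_MBS (Eve e)) \<union> range (From_PBS (Eve e))) (\<lambda>g. load H e s x g y)"
  unfolding depends_only_def load_def by auto

lemma measurable_sinr_scale [measurable]: "sinr_scale H \<gamma> \<in> borel_measurable borel"
  unfolding sinr_scale_def by measurable

context two_tier_network
begin

lemma users_pos: "0 < users H"
  using users_ge_1 by simp

lemma sinr_scale_nonneg: "0 \<le> \<gamma> \<Longrightarrow> 0 \<le> sinr_scale H \<gamma> r"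
  using pow_pos beta_pos by (simp add: sinr_scale_def)

lemma measurable_all_pos [measurable]: "all_pos H \<in> measurable (Om H) positions"
  unfolding all_pos_def by (rule measurable_indep_family[OF processes_indep])

lemma measurable_all_gains [measurable]: "all_gains H \<in> measurable (Om H) gains"
  unfolding all_gains_def by (rule measurable_indep_family[OF gains_indep])

lemma measurable_gain [measurable]: "gain H l \<in> borel_measurable (Om H)"
  using gains_indep by (auto simp: indep_vars_def)

lemma measurable_pos [measurable]: "pos H p n \<in> borel_measurable (Om H)"
proof -
  have "(\<lambda>\<omega>. all_pos H \<omega> p n) \<in> borel_measurable (Om H)"
    by (rule measurable_compose[OF measurable_all_pos measurable_position])
  then show ?thesis by (simp add: all_pos_def)
qed

lemma nn_integral_split_gains:
  assumes "(\<lambda>(x, g). F x g) \<in> borel_measurable (positions \<Otimes>\<^sub>M gains)"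
  shows "(\<integral>\<^sup>+\<omega>. F (all_pos H \<omega>) (all_gains H \<omega>) \<partial>Om H) =
    (\<integral>\<^sup>+\<omega>. \<integral>\<^sup>+\<omega>'. F (all_pos H \<omega>) (all_gains H \<omega>') \<partial>Om H \<partial>Om H)"
  using nn_integral_indep_set[OF measurable_all_pos measurable_all_gains _ assms] gains_indep_processes
  unfolding sets_vimage_algebra all_pos_def all_gains_def by simp

lemma nn_integral_exp_neg_load:
  assumes s: "0 \<le> s"
  shows "(\<integral>\<^sup>+\<omega>. ennreal (exp_neg (load H e s x (all_gains H \<omega>) y)) \<partial>Om H) = ennreal (exp_neg (mean_load H e s x y))"
proof -
  define aM where "aM n = s * pow_M H / real (users H) * beta H * dist (x (MBS (Eve e)) n) y powr - alpha1 H" for n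
  define aP where "aP n = s * pow_P H * beta H * dist (x (PBS (Eve e)) n) y powr - alpha2 H" for n
  have a: "0 \<le> aM n" "0 \<le> aP n" for n
    using s pow_pos beta_pos by (auto simp: aM_def aP_def)
  define U where "U g = (\<Sum>n. ennreal (aM n) * ennreal (g (From_MBS (Eve e) n)))" for g :: "link \<Rightarrow> real"
  define V where "V g = (\<Sum>n. ennreal (aP n) * ennreal (g (From_PBS (Eve e) n)))" for g :: "link \<Rightarrow> real"
  have [measurable]: "U \<in> borel_measurable gains" "V \<in> borel_measurable gains"
    unfolding U_def V_def by measurable
  have "(\<integral>\<^sup>+\<omega>. ennreal (exp_neg (load H e s x (all_gains H \<omega>) y)) \<partial>Om H) =
    (\<integral>\<^sup>+\<omega>. ennreal (exp_neg (U (all_gains H \<omega>))) * ennreal (exp_neg (V (all_gains H \<omega>))) * ennreal (exp_neg (ennreal (s * (delta H)\<^sup>2))) \<partial>Om H)"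
    by (simp add: load_def U_def V_def aM_def aP_def exp_neg_add ennreal_mult)
  also have "\<dots> = (\<integral>\<^sup>+\<omega>. ennreal (exp_neg (U (all_gains H \<omega>))) * ennreal (exp_neg (V (all_gains H \<omega>))) \<partial>Om H) * ennreal (exp_neg (ennreal (s * (delta H)\<^sup>2)))"
    by (rule nn_integral_multc) measurable
  also have "(\<integral>\<^sup>+\<omega>. ennreal (exp_neg (U (all_gains H \<omega>))) * ennreal (exp_neg (V (all_gains H \<omega>))) \<partial>Om H) =
    (\<integral>\<^sup>+\<omega>. ennreal (exp_neg (U (all_gains H \<omega>))) \<partial>Om H) * (\<integral>\<^sup>+\<omega>. ennreal (exp_neg (V (all_gains H \<omega>))) \<partial>Om H)"
    unfolding all_gains_def
    by (rule nn_integral_mult_blocks[OF gains_indep, where J = "range (From_MBS (Eve e))" and K = "range (From_PBS (Eve e))"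
          and F = "\<lambda>g. ennreal (exp_neg (U g))" and G = "\<lambda>g. ennreal (exp_neg (V g))"])
      (auto simp: depends_only_def U_def V_def)
  also have "(\<integral>\<^sup>+\<omega>. ennreal (exp_neg (U (all_gains H \<omega>))) \<partial>Om H) = ennreal (exp_neg (\<Sum>n. ennreal (real (users H) * ln (1 + aM n))))"
    unfolding U_def all_gains_def
    using nn_integral_exp_neg_suminf_erlang[OF gains_indep _ gain_MBS[of "Eve e"] a(1)] users_pos by (simp add: inj_def)
  also have "(\<integral>\<^sup>+\<omega>. ennreal (exp_neg (V (all_gains H \<omega>))) \<partial>Om H) = ennreal (exp_neg (\<Sum>n. ennreal (real 1 * ln (1 + aP n))))"
    unfolding V_def all_gains_def
    using nn_integral_exp_neg_suminf_erlang[OF gains_indep _ gain_PBS[of "Eve e"] a(2)] by (simp add: inj_def)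
  finally show ?thesis
    by (simp add: mean_load_def aM_def aP_def exp_neg_add ennreal_mult)
qed

lemma nn_integral_gain_le_load:
  assumes s: "0 \<le> s"
  shows "(\<integral>\<^sup>+\<omega>. indicator {g. ennreal (g (Target e)) \<le> load H e s x g y} (all_gains H \<omega>) \<partial>Om H) =
    ennreal (1 - exp_neg (mean_load H e s x y))"
proof -
  note [measurable] = measurable_load_gains[of H e s x y] sets_gain_le_load[of e H s x y]
  have "load H e s x (\<lambda>i. if i \<in> {Target e} then u i else v i) y = load H e s x v y" for u v
    by (rule depends_only_load[unfolded depends_only_def, rule_format]) auto
  then have "(\<integral>\<^sup>+\<omega>. indicator {g. ennreal (g (Target e)) \<le> load H e s x g y} (all_gains H \<omega>) \<partial>Om H) =
    (\<integral>\<^sup>+\<omega>. \<integral>\<^sup>+\<omega>'. indicator {\<omega>'. ennreal (gain H (Target e) \<omega>') \<le> load H e s x (all_gains H \<omega>) y} \<omega>' \<partial>Om H \<partial>Om H)"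
    unfolding all_gains_def
    by (subst nn_integral_resample[OF gains_indep, where J = "{Target e}"], measurable)
      (auto simp: indicator_def intro!: nn_integral_cong)
  also have "\<dots> = (\<integral>\<^sup>+\<omega>. ennreal (1 - exp_neg (load H e s x (all_gains H \<omega>) y)) \<partial>Om H)"
    by (simp add: nn_integral_exponential_le[OF gain_Target])
  also have "\<dots> = ennreal (1 - exp_neg (mean_load H e s x y))"
    by (rule nn_integral_one_minus) (auto simp: nn_integral_exp_neg_load[OF s])
  finally show ?thesis .
qed

lemma nn_integral_gains_le_load:
  assumes s: "\<And>e. 0 \<le> s e"
  shows "(\<integral>\<^sup>+\<omega>. (\<Prod>e<K. indicator {g. ennreal (g (Target e)) \<le> load H e (s e) x g (y e)} (all_gains H \<omega>)) \<partial>Om H) =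
    (\<Prod>e<K. ennreal (1 - exp_neg (mean_load H e (s e) x (y e))))"
proof -
  let ?F = "\<lambda>e g. indicator {g. ennreal (g (Target e)) \<le> load H e (s e) x g (y e)} g :: ennreal"
  let ?J = "\<lambda>e. insert (Target e) (range (From_MBS (Eve e)) \<union> range (From_PBS (Eve e)))"
  note [measurable] = sets_gain_le_load[of _ H _ x]
  have "(\<integral>\<^sup>+\<omega>. (\<Prod>e<K. ?F e (all_gains H \<omega>)) \<partial>Om H) = (\<Prod>e<K. \<integral>\<^sup>+\<omega>. ?F e (all_gains H \<omega>) \<partial>Om H)"
    unfolding all_gains_def
  proof (rule nn_integral_prod_blocks[OF gains_indep, where J = ?J and F = ?F])
    show "depends_only (?J e) (?F e)" for e
      using depends_only_load[of e H "s e" x "y e"] unfolding depends_only_def indicator_def by (simp cong: if_cong) metis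
  qed (auto simp: disjoint_family_on_def)
  then show ?thesis
    by (simp add: nn_integral_gain_le_load[OF s])
qed

end

definition neg_log_compl :: "real \<Rightarrow> ennreal" where
  "neg_log_compl v = (if 1 \<le> v then \<top> else ennreal (- ln (1 - v)))"

lemma exp_neg_neg_log_compl: "0 \<le> v \<Longrightarrow> v \<le> 1 \<Longrightarrow> exp_neg (neg_log_compl v) = 1 - v"
  by (auto simp: neg_log_compl_def exp_neg_ennreal)

lemma measurable_neg_log_compl [measurable]: "neg_log_compl \<in> borel_measurable borel"
  unfolding neg_log_compl_def by measurable

definition serves :: "'a hetnet \<Rightarrow> (process \<Rightarrow> nat \<Rightarrow> plane) \<Rightarrow> nat \<Rightarrow> bool" where
  "serves H x n \<longleftrightarrow>
     (\<forall>m. avg_power_P H (norm (x (PBS User) m)) \<le> avg_power_P H (norm (x (PBS User) n))) \<and>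
     (\<forall>l. avg_power_M H (norm (x (MBS User) l)) \<le> avg_power_P H (norm (x (PBS User) n)))"

definition target :: "'a hetnet \<Rightarrow> (process \<Rightarrow> nat \<Rightarrow> plane) \<Rightarrow> plane" where
  "target H x = x (PBS User) (LEAST n. serves H x n)"

lemma serves_user_eq: "serves_user H \<omega> n \<longleftrightarrow> serves H (all_pos H \<omega>) n"
  by (simp add: serves_user_def serves_def all_pos_def)

lemma target_pos_eq: "target_pos H \<omega> = target H (all_pos H \<omega>)"
  by (simp add: target_pos_def target_def serving_PBS_def serves_user_eq[abs_def]) (simp add: all_pos_def)

lemma depends_only_serves: "depends_only {MBS User, PBS User} (\<lambda>x. serves H x)"
  by (auto simp: depends_only_def serves_def fun_eq_iff)

lemma depends_only_target: "depends_only {MBS User, PBS User} (target H)"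
  unfolding depends_only_def
proof (intro allI impI)
  fix u v :: "process \<Rightarrow> nat \<Rightarrow> plane"
  assume eq: "\<forall>i\<in>{MBS User, PBS User}. u i = v i"
  have "serves H u = serves H v"
    by (rule depends_only_serves[unfolded depends_only_def, rule_format]) (use eq in blast)
  then show "target H u = target H v"
    using eq by (simp add: target_def)
qed

lemma pred_serves [measurable]: "(\<lambda>x. serves H x n) \<in> measurable positions (count_space UNIV)"
proof -
  note [measurable] = measurable_position
  have [measurable]: "avg_power_M H \<in> borel_measurable borel" "avg_power_P H \<in> borel_measurable borel"
    unfolding avg_power_M_def avg_power_P_def path_loss_def by measurable
  have [measurable]: "(\<lambda>x. avg_power_P H (norm (x p n))) \<in> borel_measurable positions"
    "(\<lambda>x. avg_power_M H (norm (x p n))) \<in> borel_measurable positions" for p n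
    by (rule measurable_compose[OF measurable_position], measurable)+
  have le: "Measurable.pred positions (\<lambda>x. f x \<le> g x)"
    if "f \<in> borel_measurable positions" "g \<in> borel_measurable positions" for f g :: "_ \<Rightarrow> real"
    unfolding pred_def by (rule borel_measurable_le[OF that])
  show ?thesis unfolding serves_def
    by (intro pred_intros_logic pred_intros_countable le) fact+
qed

lemma measurable_target [measurable]: "target H \<in> borel_measurable positions"
proof -
  have "(\<lambda>x. LEAST n. serves H x n) \<in> measurable positions (count_space UNIV)"
    by measurable
  then show ?thesis
    unfolding target_def[abs_def] by (rule measurable_compose_countable[OF measurable_position])
qed

lemma depends_only_mean_load:
  "depends_only {MBS (Eve e), PBS (Eve e)} (\<lambda>x. mean_load H e s x y)"
  unfolding depends_only_def mean_load_def by auto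

lemma measurable_total_load [measurable]: "total_load H \<in> borel_measurable borel"
  unfolding total_load_def by measurable

context two_tier_network
begin

lemma total_load_nonneg: "0 \<le> s \<Longrightarrow> 0 \<le> total_load H s"
  unfolding total_load_def using dens_pos interference_const_nonneg alpha_gt_2 pow_pos beta_pos
  by (intro add_nonneg_nonneg mult_nonneg_nonneg) auto

lemma total_load_0 [simp]: "total_load H 0 = 0"
  by (simp add: total_load_def)

lemma tendsto_total_load:
  assumes s: "(s \<longlongrightarrow> s0) F" and pos: "eventually (\<lambda>n. 0 \<le> s n) F"
  shows "((\<lambda>n. total_load H (s n)) \<longlongrightarrow> total_load H s0) F"
proof -
  have "eventually (\<lambda>n. 0 \<le> s n * pow_M H / real (users H) * beta H) F"
       "eventually (\<lambda>n. 0 \<le> s n * pow_P H * beta H) F"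
    using pos pow_pos beta_pos by (auto elim!: eventually_mono)
  then show ?thesis
    unfolding total_load_def using alpha_gt_2 users_pos
    by (intro tendsto_intros tendsto_powr' s) auto
qed

lemma nn_integral_exp_neg_mean_load:
  assumes s: "0 \<le> s"
  shows "(\<integral>\<^sup>+\<omega>. ennreal (exp_neg (mean_load H e s (all_pos H \<omega>) y)) \<partial>Om H) = ennreal (exp (- total_load H s))"
proof -
  define aM where "aM = s * pow_M H / real (users H) * beta H"
  define aP where "aP = s * pow_P H * beta H"
  have a: "0 \<le> aM" "0 \<le> aP" using s pow_pos beta_pos by (auto simp: aM_def aP_def)
  define U where "U x = (\<Sum>n. ennreal (real (users H) * ln (1 + aM * dist (x (MBS (Eve e)) n) y powr - alpha1 H)))"
    for x :: "process \<Rightarrow> nat \<Rightarrow> plane"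
  define V where "V x = (\<Sum>n. ennreal (real 1 * ln (1 + aP * dist (x (PBS (Eve e)) n) y powr - alpha2 H)))"
    for x :: "process \<Rightarrow> nat \<Rightarrow> plane"
  note [measurable] = measurable_position
  have [measurable]: "U \<in> borel_measurable positions" "V \<in> borel_measurable positions"
    unfolding U_def V_def by measurable
  have "(\<integral>\<^sup>+\<omega>. ennreal (exp_neg (mean_load H e s (all_pos H \<omega>) y)) \<partial>Om H) =
    (\<integral>\<^sup>+\<omega>. ennreal (exp_neg (U (all_pos H \<omega>))) * ennreal (exp_neg (V (all_pos H \<omega>))) * ennreal (exp_neg (ennreal (s * (delta H)\<^sup>2))) \<partial>Om H)"
    by (simp add: mean_load_def U_def V_def aM_def aP_def exp_neg_add ennreal_mult)
  also have "\<dots> = (\<integral>\<^sup>+\<omega>. ennreal (exp_neg (U (all_pos H \<omega>))) * ennreal (exp_neg (V (all_pos H \<omega>))) \<partial>Om H) * ennreal (exp_neg (ennreal (s * (delta H)\<^sup>2)))"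
    by (rule nn_integral_multc) measurable
  also have "(\<integral>\<^sup>+\<omega>. ennreal (exp_neg (U (all_pos H \<omega>))) * ennreal (exp_neg (V (all_pos H \<omega>))) \<partial>Om H) =
    (\<integral>\<^sup>+\<omega>. ennreal (exp_neg (U (all_pos H \<omega>))) \<partial>Om H) * (\<integral>\<^sup>+\<omega>. ennreal (exp_neg (V (all_pos H \<omega>))) \<partial>Om H)"
    unfolding all_pos_def
    by (rule nn_integral_mult_blocks[OF processes_indep, where J = "{MBS (Eve e)}" and K = "{PBS (Eve e)}"
          and F = "\<lambda>g. ennreal (exp_neg (U g))" and G = "\<lambda>g. ennreal (exp_neg (V g))"])
      (auto simp: depends_only_def U_def V_def)
  also have "(\<integral>\<^sup>+\<omega>. ennreal (exp_neg (U (all_pos H \<omega>))) \<partial>Om H) =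
      ennreal (exp_neg (ennreal (dens_M H) * ennreal (2 * pi * (aM powr (2 / alpha1 H) * interference_const (users H) (alpha1 H)))))"
    unfolding U_def all_pos_def
    using poisson_laplace[OF poisson_MBS[of "Eve e"],
        of "\<lambda>x. ennreal (real (users H) * ln (1 + aM * dist x y powr - alpha1 H))"] dens_pos
    by (simp add: nn_integral_interference[OF a(1) alpha_gt_2(1)])
  also have "(\<integral>\<^sup>+\<omega>. ennreal (exp_neg (V (all_pos H \<omega>))) \<partial>Om H) =
      ennreal (exp_neg (ennreal (dens_P H) * ennreal (2 * pi * (aP powr (2 / alpha2 H) * interference_const 1 (alpha2 H)))))"
    unfolding V_def all_pos_def
    using poisson_laplace[OF poisson_PBS[of "Eve e"],
        of "\<lambda>x. ennreal (real 1 * ln (1 + aP * dist x y powr - alpha2 H))"] dens_pos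
    unfolding nn_integral_interference[OF a(2) alpha_gt_2(2)] by simp
  finally show ?thesis
    unfolding total_load_def aM_def[symmetric] aP_def[symmetric]
    using dens_pos s interference_const_nonneg[OF alpha_gt_2(1)] interference_const_nonneg[OF alpha_gt_2(2)]
    by (simp add: ennreal_mult[symmetric] exp_neg_ennreal exp_add[symmetric])
qed

lemma nn_integral_resample_all_pos:
  assumes "F \<in> borel_measurable positions"
  shows "(\<integral>\<^sup>+\<omega>. F (all_pos H \<omega>) \<partial>Om H) =
    (\<integral>\<^sup>+\<omega>. \<integral>\<^sup>+\<omega>'. F (\<lambda>p. if p \<in> J then all_pos H \<omega>' p else all_pos H \<omega> p) \<partial>Om H \<partial>Om H)"
  unfolding all_pos_def by (rule nn_integral_resample[OF processes_indep assms])

definition tail_prob :: "real \<Rightarrow> (process \<Rightarrow> nat \<Rightarrow> plane) \<Rightarrow> nat \<Rightarrow> real" where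
  "tail_prob \<gamma> x e = exp (- total_load H (sinr_scale H \<gamma> (dist (target H x) (x Eves e))))"

lemma tail_prob_bounds: "0 \<le> \<gamma> \<Longrightarrow> 0 \<le> tail_prob \<gamma> x e" "0 \<le> \<gamma> \<Longrightarrow> tail_prob \<gamma> x e \<le> 1"
  using total_load_nonneg sinr_scale_nonneg by (auto simp: tail_prob_def)

definition eve_load :: "real \<Rightarrow> (process \<Rightarrow> nat \<Rightarrow> plane) \<Rightarrow> (link \<Rightarrow> real) \<Rightarrow> nat \<Rightarrow> ennreal" where
  "eve_load \<gamma> x g e = load H e (sinr_scale H \<gamma> (dist (target H x) (x Eves e))) x g (x Eves e)"

lemma measurable_tail_prob [measurable]: "(\<lambda>x. tail_prob \<gamma> x e) \<in> borel_measurable positions"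
  unfolding tail_prob_def using measurable_position[measurable] by measurable

lemma measurable_eve_load [measurable]:
  "(\<lambda>z. eve_load \<gamma> (fst z) (snd z) e) \<in> borel_measurable (positions \<Otimes>\<^sub>M gains)"
proof -
  note [measurable] = measurable_compose[OF measurable_fst measurable_position]
  show ?thesis
    unfolding eve_load_def by (intro measurable_load) measurable
qed

lemma measurable_mean_load_pos:
  "(\<lambda>u. mean_load H e s u y) \<in> borel_measurable positions"
  by (intro measurable_mean_load measurable_ident_sets) simp_all

lemma measurable_mean_load_all_pos:
  "(\<lambda>\<omega>. mean_load H e s (all_pos H \<omega>) y) \<in> borel_measurable (Om H)"
  by (rule measurable_compose[OF measurable_all_pos measurable_mean_load_pos])

lemma nn_integral_prod_mean_load:
  assumes s: "\<And>e. 0 \<le> s e"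
  shows "(\<integral>\<^sup>+\<omega>. (\<Prod>e<K. ennreal (1 - exp_neg (mean_load H e (s e) (all_pos H \<omega>) (y e)))) \<partial>Om H) =
    (\<Prod>e<K. ennreal (1 - exp (- total_load H (s e))))"
proof -
  note [measurable] = measurable_mean_load_all_pos measurable_mean_load_pos
  have "(\<integral>\<^sup>+\<omega>. (\<Prod>e<K. ennreal (1 - exp_neg (mean_load H e (s e) (all_pos H \<omega>) (y e)))) \<partial>Om H) =
     (\<Prod>e<K. \<integral>\<^sup>+\<omega>. ennreal (1 - exp_neg (mean_load H e (s e) (all_pos H \<omega>) (y e))) \<partial>Om H)"
    unfolding all_pos_def
  proof (rule nn_integral_prod_blocks[OF processes_indep, where J = "\<lambda>e. {MBS (Eve e), PBS (Eve e)}"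
        and F = "\<lambda>e u. ennreal (1 - exp_neg (mean_load H e (s e) u (y e)))"])
    show "depends_only {MBS (Eve e), PBS (Eve e)} (\<lambda>u. ennreal (1 - exp_neg (mean_load H e (s e) u (y e))))" for e
      using depends_only_mean_load[of e H "s e" "y e"] unfolding depends_only_def by metis
  qed (auto simp: disjoint_family_on_def)
  also have "\<dots> = (\<Prod>e<K. ennreal (1 - exp (- total_load H (s e))))"
    by (intro prod.cong refl nn_integral_one_minus[OF _ _ _ nn_integral_exp_neg_mean_load[OF s]]) simp_all
  finally show ?thesis .
qed

lemma nn_integral_resample_interferers:
  assumes \<gamma>: "0 \<le> \<gamma>" and A: "A \<in> sets positions" "depends_only {MBS User, PBS User} (\<lambda>x. x \<in> A)"
  shows "(\<integral>\<^sup>+\<omega>. indicator A (all_pos H \<omega>) * (\<Prod>e<K. ennreal (1 - exp_neg (mean_load H e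
       (sinr_scale H \<gamma> (dist (target H (all_pos H \<omega>)) (all_pos H \<omega> Eves e))) (all_pos H \<omega>) (all_pos H \<omega> Eves e)))) \<partial>Om H) =
    (\<integral>\<^sup>+\<omega>. indicator A (all_pos H \<omega>) * (\<Prod>e<K. ennreal (1 - tail_prob \<gamma> (all_pos H \<omega>) e)) \<partial>Om H)"
    (is "(\<integral>\<^sup>+\<omega>. ?F (all_pos H \<omega>) \<partial>Om H) = (\<integral>\<^sup>+\<omega>. ?G (all_pos H \<omega>) \<partial>Om H)")
proof -
  define J where "J = (\<Union>e. {MBS (Eve e), PBS (Eve e)})"
  have "?F \<in> borel_measurable positions"
  proof -
    note [measurable] = measurable_position A(1)
    have [measurable]: "(\<lambda>x. mean_load H e (sinr_scale H \<gamma> (dist (target H x) (x Eves e))) x (x Eves e)) \<in> borel_measurable positions" for e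
      by (intro measurable_mean_load) measurable
    show ?thesis by measurable
  qed
  then have "(\<integral>\<^sup>+\<omega>. ?F (all_pos H \<omega>) \<partial>Om H) =
    (\<integral>\<^sup>+\<omega>. \<integral>\<^sup>+\<omega>'. ?F (\<lambda>p. if p \<in> J then all_pos H \<omega>' p else all_pos H \<omega> p) \<partial>Om H \<partial>Om H)"
    by (rule nn_integral_resample_all_pos)
  moreover have "(\<integral>\<^sup>+\<omega>. \<integral>\<^sup>+\<omega>'. ?F (\<lambda>p. if p \<in> J then all_pos H \<omega>' p else all_pos H \<omega> p) \<partial>Om H \<partial>Om H) =
      (\<integral>\<^sup>+\<omega>. ?G (all_pos H \<omega>) \<partial>Om H)"
  proof (rule nn_integral_cong)
    fix \<omega>
    define x where "x = all_pos H \<omega>"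
    define r where "r \<omega>' = (\<lambda>p. if p \<in> J then all_pos H \<omega>' p else x p)" for \<omega>'
    define s where "s e = sinr_scale H \<gamma> (dist (target H x) (x Eves e))" for e
    have "r \<omega>' Eves = x Eves" for \<omega>'
      by (auto simp: r_def J_def)
    moreover have "target H (r \<omega>') = target H x" for \<omega>'
      by (rule depends_only_target[unfolded depends_only_def, rule_format]) (auto simp: r_def J_def)
    moreover have "indicator A (r \<omega>') = (indicator A x :: ennreal)" for \<omega>'
    proof -
      have "r \<omega>' \<in> A \<longleftrightarrow> x \<in> A"
        by (rule A(2)[unfolded depends_only_def, rule_format]) (auto simp: r_def J_def)
      then show ?thesis by (simp add: indicator_def)
    qed
    moreover have "mean_load H e s (r \<omega>') y = mean_load H e s (all_pos H \<omega>') y" for e s y \<omega>'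
      by (rule depends_only_mean_load[unfolded depends_only_def, rule_format]) (auto simp: r_def J_def)
    ultimately have "(\<integral>\<^sup>+\<omega>'. ?F (r \<omega>') \<partial>Om H) = (\<integral>\<^sup>+\<omega>'. indicator A x *
        (\<Prod>e<K. ennreal (1 - exp_neg (mean_load H e (s e) (all_pos H \<omega>') (x Eves e)))) \<partial>Om H)"
      by (simp add: s_def)
    also have "\<dots> = indicator A x *
        (\<integral>\<^sup>+\<omega>'. (\<Prod>e<K. ennreal (1 - exp_neg (mean_load H e (s e) (all_pos H \<omega>') (x Eves e)))) \<partial>Om H)"
      using measurable_mean_load_all_pos[measurable] by (intro nn_integral_cmult) measurable
    also have "\<dots> = ?G x"
      unfolding tail_prob_def s_def by (subst nn_integral_prod_mean_load) (simp_all add: sinr_scale_nonneg \<gamma>)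
    finally show "(\<integral>\<^sup>+\<omega>'. ?F (\<lambda>p. if p \<in> J then all_pos H \<omega>' p else all_pos H \<omega> p) \<partial>Om H) = ?G (all_pos H \<omega>)"
      unfolding r_def x_def .
  qed
  ultimately show ?thesis
    by (rule trans)
qed

end

lemma tendsto_prod_indicator:
  "(\<lambda>K. \<Prod>e<K. indicator (C e) z :: ennreal) \<longlonglongrightarrow> indicator (\<Inter>e. C e) z"
proof (cases "z \<in> (\<Inter>e. C e)")
  case False
  then obtain e where e: "z \<notin> C e" by auto
  have "eventually (\<lambda>K. (\<Prod>e<K. indicator (C e) z :: ennreal) = 0) sequentially"
    using eventually_gt_at_top[of e]
  proof eventually_elim
    case (elim K)
    then show ?case using e by (intro prod_zero bexI[of _ e]) auto
  qed
  then show ?thesis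
    using False by (simp add: tendsto_eventually)
qed simp

context two_tier_network
begin

definition safe :: "real \<Rightarrow> nat \<Rightarrow> ((process \<Rightarrow> nat \<Rightarrow> plane) \<times> (link \<Rightarrow> real)) set" where
  "safe \<gamma> e = {z. ennreal (snd z (Target e)) \<le> eve_load \<gamma> (fst z) (snd z) e}"

definition eve_rate :: "real \<Rightarrow> ennreal" where
  "eve_rate \<gamma> = ennreal (dens_E H) *
     (\<integral>\<^sup>+r. ennreal (2 * pi * r) * ennreal (exp (- total_load H (sinr_scale H \<gamma> r))) \<partial>lborel)"

lemma sets_safe: "safe \<gamma> e \<in> sets (positions \<Otimes>\<^sub>M gains)"
proof -
  have "(\<lambda>z. ennreal (snd z (Target e))) \<in> borel_measurable (positions \<Otimes>\<^sub>M gains)"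
    by (rule measurable_compose[OF measurable_compose[OF measurable_snd measurable_component_singleton]]) simp_all
  from borel_measurable_le[OF this measurable_eve_load[of \<gamma> e]] show ?thesis
    by (simp add: safe_def space_pair_measure)
qed

lemma sets_all_safe: "(\<Inter>e. safe \<gamma> e) \<in> sets (positions \<Otimes>\<^sub>M gains)"
  using sets_safe by (intro sets.countable_INT) auto

abbreviation state :: "'a \<Rightarrow> (process \<Rightarrow> nat \<Rightarrow> plane) \<times> (link \<Rightarrow> real)" where
  "state \<omega> \<equiv> (all_pos H \<omega>, all_gains H \<omega>)"

lemma nn_integral_prod_safe:
  assumes \<gamma>: "0 \<le> \<gamma>" and A: "A \<in> sets positions" "depends_only {MBS User, PBS User} (\<lambda>x. x \<in> A)"
  shows "(\<integral>\<^sup>+\<omega>. indicator A (all_pos H \<omega>) * (\<Prod>e<K. indicator (safe \<gamma> e) (state \<omega>)) \<partial>Om H) =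
    (\<integral>\<^sup>+\<omega>. indicator A (all_pos H \<omega>) * (\<Prod>e<K. ennreal (1 - tail_prob \<gamma> (all_pos H \<omega>) e)) \<partial>Om H)"
proof -
  define F where "F x g = indicator A x * (\<Prod>e<K. indicator (safe \<gamma> e) (x, g) :: ennreal)" for x g
  note [measurable] = A(1) sets_safe
  have "(\<lambda>(x, g). F x g) \<in> borel_measurable (positions \<Otimes>\<^sub>M gains)"
    unfolding F_def by measurable
  then have "(\<integral>\<^sup>+\<omega>. F (all_pos H \<omega>) (all_gains H \<omega>) \<partial>Om H) =
      (\<integral>\<^sup>+\<omega>. \<integral>\<^sup>+\<omega>'. F (all_pos H \<omega>) (all_gains H \<omega>') \<partial>Om H \<partial>Om H)"
    by (rule nn_integral_split_gains)
  moreover have "(\<integral>\<^sup>+\<omega>'. F x (all_gains H \<omega>') \<partial>Om H) =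
     indicator A x * (\<Prod>e<K. ennreal (1 - exp_neg (mean_load H e
       (sinr_scale H \<gamma> (dist (target H x) (x Eves e))) x (x Eves e))))" for x
  proof -
    let ?s = "\<lambda>e. sinr_scale H \<gamma> (dist (target H x) (x Eves e))"
    let ?P = "\<lambda>\<omega>'. \<Prod>e<K. indicator {g. ennreal (g (Target e)) \<le> load H e (?s e) x g (x Eves e)} (all_gains H \<omega>') :: ennreal"
    note [measurable] = sets_gain_le_load
    have "(\<integral>\<^sup>+\<omega>'. F x (all_gains H \<omega>') \<partial>Om H) = (\<integral>\<^sup>+\<omega>'. indicator A x * ?P \<omega>' \<partial>Om H)"
      by (simp add: F_def safe_def eve_load_def indicator_def)
    also have "\<dots> = indicator A x * (\<integral>\<^sup>+\<omega>'. ?P \<omega>' \<partial>Om H)"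
      by (rule nn_integral_cmult) measurable
    also have "(\<integral>\<^sup>+\<omega>'. ?P \<omega>' \<partial>Om H) = (\<Prod>e<K. ennreal (1 - exp_neg (mean_load H e (?s e) x (x Eves e))))"
      by (rule nn_integral_gains_le_load) (rule sinr_scale_nonneg[OF \<gamma>])
    finally show ?thesis .
  qed
  ultimately show ?thesis
    using nn_integral_resample_interferers[OF \<gamma> A, of K] by (simp add: F_def)
qed

lemma nn_integral_resample_eves:
  assumes \<gamma>: "0 \<le> \<gamma>" and A: "A \<in> sets positions" "depends_only {MBS User, PBS User} (\<lambda>x. x \<in> A)"
  shows "(\<integral>\<^sup>+\<omega>. indicator A (all_pos H \<omega>) * ennreal (exp_neg (\<Sum>e. neg_log_compl (tail_prob \<gamma> (all_pos H \<omega>) e))) \<partial>Om H) =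
    (\<integral>\<^sup>+\<omega>. indicator A (all_pos H \<omega>) * ennreal (exp_neg (eve_rate \<gamma>)) \<partial>Om H)"
    (is "(\<integral>\<^sup>+\<omega>. ?F (all_pos H \<omega>) \<partial>Om H) = _")
proof -
  note [measurable] = A(1)
  have "?F \<in> borel_measurable positions"
    by measurable
  then have "(\<integral>\<^sup>+\<omega>. ?F (all_pos H \<omega>) \<partial>Om H) =
    (\<integral>\<^sup>+\<omega>. \<integral>\<^sup>+\<omega>'. ?F (\<lambda>p. if p \<in> {Eves} then all_pos H \<omega>' p else all_pos H \<omega> p) \<partial>Om H \<partial>Om H)"
    by (rule nn_integral_resample_all_pos)
  moreover have "(\<integral>\<^sup>+\<omega>'. ?F (\<lambda>p. if p \<in> {Eves} then all_pos H \<omega>' p else x p) \<partial>Om H) =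
      indicator A x * ennreal (exp_neg (eve_rate \<gamma>))" for x
  proof -
    define r where "r \<omega>' = (\<lambda>p. if p \<in> {Eves} then all_pos H \<omega>' p else x p)" for \<omega>'
    define f where "f y = neg_log_compl (exp (- total_load H (sinr_scale H \<gamma> (dist y (target H x)))))" for y
    have [measurable]: "f \<in> borel_measurable borel" unfolding f_def by measurable
    have "r \<omega>' \<in> A \<longleftrightarrow> x \<in> A" for \<omega>'
      by (rule A(2)[unfolded depends_only_def, rule_format]) (auto simp: r_def)
    moreover have "target H (r \<omega>') = target H x" for \<omega>'
      by (rule depends_only_target[unfolded depends_only_def, rule_format]) (auto simp: r_def)
    moreover have "r \<omega>' Eves e = pos H Eves e \<omega>'" for \<omega>' e
      by (simp add: r_def all_pos_def)
    ultimately have "(\<integral>\<^sup>+\<omega>'. ?F (r \<omega>') \<partial>Om H) =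
        (\<integral>\<^sup>+\<omega>'. indicator A x * ennreal (exp_neg (\<Sum>e. f (pos H Eves e \<omega>'))) \<partial>Om H)"
      by (simp add: f_def tail_prob_def indicator_def dist_commute)
    also have "\<dots> = indicator A x * (\<integral>\<^sup>+\<omega>'. ennreal (exp_neg (\<Sum>e. f (pos H Eves e \<omega>'))) \<partial>Om H)"
      by (rule nn_integral_cmult) measurable
    also have "(\<integral>\<^sup>+\<omega>'. ennreal (exp_neg (\<Sum>e. f (pos H Eves e \<omega>'))) \<partial>Om H) =
        ennreal (exp_neg (ennreal (dens_E H) * (\<integral>\<^sup>+y. ennreal (1 - exp_neg (f y)) \<partial>lborel)))"
      using dens_pos by (intro poisson_laplace[OF poisson_Eves]) auto
    also have "(\<integral>\<^sup>+y. ennreal (1 - exp_neg (f y)) \<partial>lborel) =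
        (\<integral>\<^sup>+y. ennreal (exp (- total_load H (sinr_scale H \<gamma> (dist y (target H x))))) \<partial>lborel)"
      using total_load_nonneg[OF sinr_scale_nonneg[OF \<gamma>]] by (simp add: f_def exp_neg_neg_log_compl)
    also have "\<dots> = (\<integral>\<^sup>+r. ennreal (2 * pi * r) * ennreal (exp (- total_load H (sinr_scale H \<gamma> r))) \<partial>lborel)"
      by (rule nn_integral_dist_plane[where f = "\<lambda>r. ennreal (exp (- total_load H (sinr_scale H \<gamma> r)))"]) measurable
    finally show ?thesis
      unfolding r_def eve_rate_def .
  qed
  ultimately show ?thesis
    by simp
qed

lemma nn_integral_all_safe:
  assumes \<gamma>: "0 \<le> \<gamma>" and A: "A \<in> sets positions" "depends_only {MBS User, PBS User} (\<lambda>x. x \<in> A)"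
  shows "(\<integral>\<^sup>+\<omega>. indicator A (all_pos H \<omega>) * indicator (\<Inter>e. safe \<gamma> e) (state \<omega>) \<partial>Om H) =
    emeasure (Om H) {\<omega>\<in>space (Om H). all_pos H \<omega> \<in> A} * ennreal (exp_neg (eve_rate \<gamma>))"
proof -
  note [measurable] = A(1) sets_safe sets_all_safe
  have "(\<lambda>K. \<integral>\<^sup>+\<omega>. indicator A (all_pos H \<omega>) * (\<Prod>e<K. indicator (safe \<gamma> e) (state \<omega>)) \<partial>Om H)
      \<longlonglongrightarrow> (\<integral>\<^sup>+\<omega>. indicator A (all_pos H \<omega>) * indicator (\<Inter>e. safe \<gamma> e) (state \<omega>) \<partial>Om H)"
  proof (rule nn_integral_dominated_convergence[where w = "\<lambda>_. 1"])
    show "AE \<omega> in Om H. indicator A (all_pos H \<omega>) * (\<Prod>e<K. indicator (safe \<gamma> e) (state \<omega>)) \<le> (1::ennreal)" for K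
      by (intro AE_I2 mult_le_one prod_le_1) (auto simp: indicator_def)
    show "AE \<omega> in Om H. (\<lambda>K. indicator A (all_pos H \<omega>) * (\<Prod>e<K. indicator (safe \<gamma> e) (state \<omega>)) :: ennreal)
        \<longlonglongrightarrow> indicator A (all_pos H \<omega>) * indicator (\<Inter>e. safe \<gamma> e) (state \<omega>)"
      by (intro AE_I2 ennreal_tendsto_cmult tendsto_prod_indicator) (auto simp: indicator_def)
  qed (auto simp: emeasure_space_1)
  moreover have "(\<lambda>K. \<integral>\<^sup>+\<omega>. indicator A (all_pos H \<omega>) * (\<Prod>e<K. ennreal (1 - tail_prob \<gamma> (all_pos H \<omega>) e)) \<partial>Om H)
      \<longlonglongrightarrow> (\<integral>\<^sup>+\<omega>. indicator A (all_pos H \<omega>) * ennreal (exp_neg (\<Sum>e. neg_log_compl (tail_prob \<gamma> (all_pos H \<omega>) e))) \<partial>Om H)"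
  proof (rule nn_integral_dominated_convergence[where w = "\<lambda>_. 1"])
    have eq: "ennreal (1 - tail_prob \<gamma> x e) = ennreal (exp_neg (neg_log_compl (tail_prob \<gamma> x e)))" for x e
      using tail_prob_bounds[OF \<gamma>] by (simp add: exp_neg_neg_log_compl)
    show "AE \<omega> in Om H. indicator A (all_pos H \<omega>) * (\<Prod>e<K. ennreal (1 - tail_prob \<gamma> (all_pos H \<omega>) e)) \<le> 1" for K
      by (intro AE_I2 mult_le_one prod_le_1) (auto simp: indicator_def eq)
    show "AE \<omega> in Om H. (\<lambda>K. indicator A (all_pos H \<omega>) * (\<Prod>e<K. ennreal (1 - tail_prob \<gamma> (all_pos H \<omega>) e)))
        \<longlonglongrightarrow> indicator A (all_pos H \<omega>) * ennreal (exp_neg (\<Sum>e. neg_log_compl (tail_prob \<gamma> (all_pos H \<omega>) e)))"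
      unfolding eq by (subst prod_ennreal, simp)
        (intro AE_I2 ennreal_tendsto_cmult tendsto_ennrealI exp_neg_suminf; simp add: indicator_def)
  qed (auto simp: emeasure_space_1)
  ultimately have "(\<integral>\<^sup>+\<omega>. indicator A (all_pos H \<omega>) * indicator (\<Inter>e. safe \<gamma> e) (state \<omega>) \<partial>Om H) =
     (\<integral>\<^sup>+\<omega>. indicator A (all_pos H \<omega>) * ennreal (exp_neg (\<Sum>e. neg_log_compl (tail_prob \<gamma> (all_pos H \<omega>) e))) \<partial>Om H)"
    unfolding nn_integral_prod_safe[OF \<gamma> A] by (rule LIMSEQ_unique)
  also have "\<dots> = (\<integral>\<^sup>+\<omega>. indicator A (all_pos H \<omega>) * ennreal (exp_neg (eve_rate \<gamma>)) \<partial>Om H)"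
    by (rule nn_integral_resample_eves[OF \<gamma> A])
  also have "\<dots> = (\<integral>\<^sup>+\<omega>. indicator A (all_pos H \<omega>) \<partial>Om H) * ennreal (exp_neg (eve_rate \<gamma>))"
    by (rule nn_integral_multc) measurable
  also have "(\<integral>\<^sup>+\<omega>. indicator A (all_pos H \<omega>) \<partial>Om H) =
      (\<integral>\<^sup>+\<omega>. indicator {\<omega>\<in>space (Om H). all_pos H \<omega> \<in> A} \<omega> \<partial>Om H)"
    by (intro nn_integral_cong) (simp add: indicator_def)
  also have "\<dots> = emeasure (Om H) {\<omega>\<in>space (Om H). all_pos H \<omega> \<in> A}"
    by (rule nn_integral_indicator) measurable
  finally show ?thesis .
qed

lemma nn_integral_exp_neg_load_eve:
  assumes s: "0 \<le> s"
  shows "(\<integral>\<^sup>+\<omega>. ennreal (exp_neg (load H e s (all_pos H \<omega>) (all_gains H \<omega>) (all_pos H \<omega> Eves e))) \<partial>Om H) =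
    ennreal (exp (- total_load H s))"
proof -
  define F where "F x g = ennreal (exp_neg (load H e s x g (x Eves e)))" for x g
  have "(\<lambda>z. load H e s (fst z) (snd z) (fst z Eves e)) \<in> borel_measurable (positions \<Otimes>\<^sub>M gains)"
    by (intro measurable_load measurable_compose[OF measurable_fst measurable_position]) auto
  then have "(\<lambda>(x, g). F x g) \<in> borel_measurable (positions \<Otimes>\<^sub>M gains)"
    unfolding F_def case_prod_beta by measurable
  then have "(\<integral>\<^sup>+\<omega>. F (all_pos H \<omega>) (all_gains H \<omega>) \<partial>Om H) =
      (\<integral>\<^sup>+\<omega>. \<integral>\<^sup>+\<omega>'. F (all_pos H \<omega>) (all_gains H \<omega>') \<partial>Om H \<partial>Om H)"
    by (rule nn_integral_split_gains)
  also have "\<dots> = (\<integral>\<^sup>+\<omega>. ennreal (exp_neg (mean_load H e s (all_pos H \<omega>) (all_pos H \<omega> Eves e))) \<partial>Om H)"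
    by (simp add: F_def nn_integral_exp_neg_load[OF s])
  also have "\<dots> = ennreal (exp (- total_load H s))"
  proof -
    let ?G = "\<lambda>x. ennreal (exp_neg (mean_load H e s x (x Eves e)))"
    let ?r = "\<lambda>\<omega> \<omega>' p. if p \<in> {MBS (Eve e), PBS (Eve e)} then all_pos H \<omega>' p else all_pos H \<omega> p"
    have [measurable]: "(\<lambda>x. mean_load H e s x (x Eves e)) \<in> borel_measurable positions"
      by (intro measurable_mean_load measurable_position measurable_ident_sets) auto
    have "?G \<in> borel_measurable positions"
      by measurable
    then have "(\<integral>\<^sup>+\<omega>. ?G (all_pos H \<omega>) \<partial>Om H) = (\<integral>\<^sup>+\<omega>. \<integral>\<^sup>+\<omega>'. ?G (?r \<omega> \<omega>') \<partial>Om H \<partial>Om H)"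
      by (rule nn_integral_resample_all_pos)
    moreover have "mean_load H e s (?r \<omega> \<omega>') y = mean_load H e s (all_pos H \<omega>') y" for \<omega> \<omega>' y
      by (rule depends_only_mean_load[unfolded depends_only_def, rule_format]) auto
    ultimately show ?thesis
      by (simp add: nn_integral_exp_neg_mean_load[OF s] emeasure_space_1)
  qed
  finally show ?thesis
    by (simp add: F_def)
qed

end

subsection \<open>The mean number of eavesdroppers above a threshold\<close>

lemma nn_integral_gaussian_plane:
  fixes b :: real
  assumes "0 < b"
  shows "(\<integral>\<^sup>+r. ennreal (2 * pi * r) * ennreal (exp (- (b * r\<^sup>2))) \<partial>lborel) = ennreal (pi / b)"
proof -
  have "(\<integral>\<^sup>+r. ennreal (2 * pi * r) * ennreal (exp (- (b * r\<^sup>2))) \<partial>lborel) =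
     (\<integral>\<^sup>+r. ennreal (2 * pi * r * exp (- (b * r\<^sup>2))) * indicator {0..} r \<partial>lborel)"
    by (intro nn_integral_cong)
      (auto simp: indicator_def ennreal_mult'' [symmetric] ennreal_neg mult_nonneg_nonpos mult_nonpos_nonneg)
  also have "\<dots> = ennreal (0 - (- (pi / b) * exp (- (b * 0\<^sup>2))))"
  proof (rule nn_integral_FTC_atLeast)
    show "((\<lambda>r. - (pi / b) * exp (- (b * r\<^sup>2))) has_real_derivative 2 * pi * r * exp (- (b * r\<^sup>2))) (at r)" for r
      using assms by (auto intro!: derivative_eq_intros)
    have "filterlim (\<lambda>r::real. b * r\<^sup>2) at_top at_top"
      using assms by (intro filterlim_tendsto_pos_mult_at_top[OF tendsto_const] filterlim_pow_at_top filterlim_ident) auto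
    then have "((\<lambda>r. exp (- (b * r\<^sup>2))) \<longlongrightarrow> 0) at_top"
      by (intro filterlim_compose[OF exp_at_bot]) (simp add: filterlim_uminus_at_bot)
    then show "((\<lambda>r. - (pi / b) * exp (- (b * r\<^sup>2))) \<longlongrightarrow> 0) at_top"
      using tendsto_mult_right_zero by blast
  qed auto
  finally show ?thesis by simp
qed

context two_tier_network
begin

lemma exponent_eq_total_load:
  assumes "0 \<le> \<gamma>" "0 \<le> r"
  shows "exponent H \<gamma> r = total_load H (sinr_scale H \<gamma> r)"
proof -
  have pos: "0 < pow_M H" "0 < pow_P H" "0 < beta H" "0 < alpha1 H" "0 < alpha2 H"
    using pow_pos beta_pos alpha_gt_2 by auto
  have "sinr_scale H \<gamma> r * pow_M H / real (users H) * beta H = (\<gamma> * pow_M H / (pow_P H * real (users H))) * r powr alpha2 H"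
    using pos by (simp add: sinr_scale_def field_simps)
  then have M: "(sinr_scale H \<gamma> r * pow_M H / real (users H) * beta H) powr (2 / alpha1 H) =
      (\<gamma> * pow_M H / (pow_P H * real (users H))) powr (2 / alpha1 H) * r powr (2 * alpha2 H / alpha1 H)"
    by (simp only:) (subst powr_mult, use assms pos in \<open>simp_all add: powr_powr mult.commute\<close>)
  have "sinr_scale H \<gamma> r * pow_P H * beta H = \<gamma> * r powr alpha2 H"
    using pos by (simp add: sinr_scale_def field_simps)
  then have P: "(sinr_scale H \<gamma> r * pow_P H * beta H) powr (2 / alpha2 H) = \<gamma> powr (2 / alpha2 H) * r\<^sup>2"
    using assms pos by (simp add: powr_mult powr_powr flip: powr_numeral)
  have "exponent H \<gamma> r = sinr_scale H \<gamma> r * (delta H)\<^sup>2 +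
     2 * pi * dens_M H * ((sinr_scale H \<gamma> r * pow_M H / real (users H) * beta H) powr (2 / alpha1 H) * interference_const (users H) (alpha1 H)) +
     2 * pi\<^sup>2 * dens_P H / alpha2 H * \<gamma> powr (2 / alpha2 H) * (1 / sin (2 * pi / alpha2 H)) * r\<^sup>2"
    unfolding exponent_def M interference_const_def sum_distrib_left unfolding sinr_scale_def
    by (intro arg_cong2[where f = "(+)"] refl sum.cong) (simp_all add: ac_simps)
  also have "2 * pi\<^sup>2 * dens_P H / alpha2 H * \<gamma> powr (2 / alpha2 H) * (1 / sin (2 * pi / alpha2 H)) * r\<^sup>2 =
     dens_P H * (2 * pi * ((sinr_scale H \<gamma> r * pow_P H * beta H) powr (2 / alpha2 H) * interference_const 1 (alpha2 H)))"
    unfolding P interference_const_1[OF alpha_gt_2(2)] by (simp add: power2_eq_square)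
  finally show ?thesis
    by (simp add: total_load_def)
qed

lemma eve_rate_eq:
  assumes "0 \<le> \<gamma>"
  shows "eve_rate \<gamma> = ennreal (2 * pi * dens_E H) *
    (\<integral>\<^sup>+x\<in>{0<..}. ennreal (exp (- exponent H \<gamma> x) * x) \<partial>lborel)"
proof -
  have "(\<integral>\<^sup>+r. ennreal (2 * pi * r) * ennreal (exp (- total_load H (sinr_scale H \<gamma> r))) \<partial>lborel) =
      (\<integral>\<^sup>+r. ennreal (2 * pi) * (ennreal (exp (- exponent H \<gamma> r) * r) * indicator {0<..} r) \<partial>lborel)"
  proof (rule nn_integral_cong)
    fix r :: real
    show "ennreal (2 * pi * r) * ennreal (exp (- total_load H (sinr_scale H \<gamma> r))) =
      ennreal (2 * pi) * (ennreal (exp (- exponent H \<gamma> r) * r) * indicator {0<..} r)"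
    proof (cases "0 < r")
      case True
      then show ?thesis
        using assms by (simp add: exponent_eq_total_load ennreal_mult'[symmetric] ac_simps)
    next
      case False
      then have "2 * pi * r \<le> 0" by (simp add: mult_nonneg_nonpos)
      then show ?thesis using False by (simp add: ennreal_neg)
    qed
  qed
  also have "\<dots> = ennreal (2 * pi) * (\<integral>\<^sup>+x\<in>{0<..}. ennreal (exp (- exponent H \<gamma> x) * x) \<partial>lborel)"
    unfolding exponent_def by (rule nn_integral_cmult) measurable
  finally show ?thesis
    using dens_pos by (simp add: eve_rate_def ennreal_mult ac_simps)
qed

definition pico_const :: real where
  "pico_const = 2 * pi * dens_P H * interference_const 1 (alpha2 H)"

lemma pico_const_pos: "0 < pico_const"
proof -
  have "0 < sin (2 * pi / alpha2 H)"
    using alpha_gt_2 by (intro sin_gt_zero) (auto simp: field_simps)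
  then show ?thesis
    unfolding pico_const_def interference_const_1[OF alpha_gt_2(2)] using dens_pos alpha_gt_2 by simp
qed

lemma total_load_ge:
  assumes "0 \<le> \<gamma>" "0 \<le> r"
  shows "pico_const * \<gamma> powr (2 / alpha2 H) * r\<^sup>2 \<le> total_load H (sinr_scale H \<gamma> r)"
proof -
  have pos: "0 < pow_M H" "0 < pow_P H" "0 < beta H" "0 < alpha1 H" "0 < alpha2 H"
    using pow_pos beta_pos alpha_gt_2 by auto
  have "sinr_scale H \<gamma> r * pow_P H * beta H = \<gamma> * r powr alpha2 H"
    using pos by (simp add: sinr_scale_def field_simps)
  then have "(sinr_scale H \<gamma> r * pow_P H * beta H) powr (2 / alpha2 H) = \<gamma> powr (2 / alpha2 H) * r\<^sup>2"
    using assms pos by (simp add: powr_mult powr_powr flip: powr_numeral)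
  then show ?thesis
    using interference_const_nonneg[OF alpha_gt_2(1), of "users H"] dens_pos sinr_scale_nonneg[OF assms(1), of r]
    by (simp add: total_load_def pico_const_def)
qed

lemma eve_rate_integrand_le:
  assumes "0 \<le> \<gamma>0" "\<gamma>0 \<le> \<gamma>"
  shows "ennreal (2 * pi * r) * ennreal (exp (- total_load H (sinr_scale H \<gamma> r))) \<le>
    ennreal (2 * pi * r) * ennreal (exp (- (pico_const * \<gamma>0 powr (2 / alpha2 H) * r\<^sup>2)))"
proof (cases "0 \<le> r")
  case True
  have "pico_const * \<gamma>0 powr (2 / alpha2 H) * r\<^sup>2 \<le> pico_const * \<gamma> powr (2 / alpha2 H) * r\<^sup>2"
    using assms pico_const_pos alpha_gt_2 by (intro mult_right_mono mult_left_mono powr_mono2) auto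
  then show ?thesis
    using total_load_ge[of \<gamma> r] True assms by (intro mult_left_mono ennreal_leI) auto
qed (simp add: ennreal_neg mult_nonneg_nonpos)

lemma eve_rate_le:
  assumes "0 < \<gamma>"
  shows "eve_rate \<gamma> \<le> ennreal (dens_E H * pi / pico_const * \<gamma> powr - (2 / alpha2 H))"
proof -
  have b: "0 < pico_const * \<gamma> powr (2 / alpha2 H)"
    using assms pico_const_pos by simp
  have "eve_rate \<gamma> \<le> ennreal (dens_E H) * ennreal (pi / (pico_const * \<gamma> powr (2 / alpha2 H)))"
    unfolding eve_rate_def nn_integral_gaussian_plane[OF b, symmetric]
    using assms by (intro mult_left_mono nn_integral_mono eve_rate_integrand_le) auto
  also have "\<dots> = ennreal (dens_E H * pi / pico_const * \<gamma> powr - (2 / alpha2 H))"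
    using dens_pos b by (simp add: ennreal_mult'[symmetric] powr_minus field_simps)
  finally show ?thesis .
qed

lemma exp_neg_eve_rate_at_top: "(\<lambda>n. exp_neg (eve_rate (real n))) \<longlonglongrightarrow> 1"
proof -
  have "- (2 / alpha2 H) < 0"
    using alpha_gt_2 by simp
  then have "(\<lambda>n. real n powr - (2 / alpha2 H)) \<longlonglongrightarrow> 0"
    by (rule tendsto_neg_powr[OF _ filterlim_real_sequentially])
  then have lim: "(\<lambda>n. ennreal (dens_E H * pi / pico_const * real n powr - (2 / alpha2 H))) \<longlonglongrightarrow> ennreal 0"
    using tendsto_ennrealI[OF tendsto_mult_right_zero] by blast
  have ub: "eventually (\<lambda>n. eve_rate (real n) \<le> ennreal (dens_E H * pi / pico_const * real n powr - (2 / alpha2 H))) sequentially"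
    using eventually_gt_at_top[of "0::nat"] by (rule eventually_mono) (rule eve_rate_le, simp only: of_nat_0_less_iff)
  have lb: "eventually (\<lambda>n. 0 \<le> eve_rate (real n)) sequentially"
    by simp
  have "(\<lambda>n. eve_rate (real n)) \<longlonglongrightarrow> 0"
    by (rule tendsto_sandwich[OF lb ub tendsto_const lim[unfolded ennreal_0]])
  from tendsto_exp_neg[OF this] show ?thesis by simp
qed

lemma tendsto_eve_rate:
  assumes "0 < \<gamma>" and g: "g \<longlonglongrightarrow> \<gamma>" and ge: "\<And>n. \<gamma> / 2 \<le> g n"
  shows "(\<lambda>n. eve_rate (g n)) \<longlonglongrightarrow> eve_rate \<gamma>"
  unfolding eve_rate_def
proof (intro ennreal_tendsto_cmult nn_integral_dominated_convergence
    [where w = "\<lambda>r. ennreal (2 * pi * r) * ennreal (exp (- (pico_const * (\<gamma> / 2) powr (2 / alpha2 H) * r\<^sup>2)))"])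
  have "0 < pico_const * (\<gamma> / 2) powr (2 / alpha2 H)"
    using assms pico_const_pos by simp
  then show "(\<integral>\<^sup>+r. ennreal (2 * pi * r) * ennreal (exp (- (pico_const * (\<gamma> / 2) powr (2 / alpha2 H) * r\<^sup>2))) \<partial>lborel) < \<infinity>"
    by (subst nn_integral_gaussian_plane) auto
  show "AE r in lborel. ennreal (2 * pi * r) * ennreal (exp (- total_load H (sinr_scale H (g n) r))) \<le>
      ennreal (2 * pi * r) * ennreal (exp (- (pico_const * (\<gamma> / 2) powr (2 / alpha2 H) * r\<^sup>2)))" for n
    using assms ge by (intro AE_I2 eve_rate_integrand_le) auto
  have "(\<lambda>n. total_load H (sinr_scale H (g n) r)) \<longlonglongrightarrow> total_load H (sinr_scale H \<gamma> r)" for r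
  proof (rule tendsto_total_load)
    show "(\<lambda>n. sinr_scale H (g n) r) \<longlonglongrightarrow> sinr_scale H \<gamma> r"
      unfolding sinr_scale_def using pow_pos beta_pos by (intro tendsto_intros g) auto
    have "0 \<le> g n" for n using ge[of n] assms by linarith
    then show "eventually (\<lambda>n. 0 \<le> sinr_scale H (g n) r) sequentially"
      by (simp add: sinr_scale_nonneg)
  qed
  then show "AE r in lborel. (\<lambda>n. ennreal (2 * pi * r) * ennreal (exp (- total_load H (sinr_scale H (g n) r))))
      \<longlonglongrightarrow> ennreal (2 * pi * r) * ennreal (exp (- total_load H (sinr_scale H \<gamma> r)))"
    by (intro AE_I2 ennreal_tendsto_cmult tendsto_ennrealI tendsto_exp tendsto_minus) simp_all
qed simp_all

lemma eve_rate_0: "eve_rate 0 = \<top>"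
proof -
  define I where "I = (\<integral>\<^sup>+r. ennreal (2 * pi * r) \<partial>lborel)"
  have I: "ennreal (pi / b) \<le> I" if "0 < b" for b
    unfolding I_def nn_integral_gaussian_plane[OF that, symmetric]
  proof (rule nn_integral_mono)
    fix r :: real
    have "ennreal (exp (- (b * r\<^sup>2))) \<le> 1" using that by simp
    then show "ennreal (2 * pi * r) * ennreal (exp (- (b * r\<^sup>2))) \<le> ennreal (2 * pi * r)"
      using mult_left_mono[of "ennreal (exp (- (b * r\<^sup>2)))" 1 "ennreal (2 * pi * r)"] by simp
  qed
  have "I \<noteq> ennreal c" if "0 \<le> c" for c
  proof
    assume "I = ennreal c"
    moreover have "pi / (pi / (c + 1)) = c + 1"
      using that by (simp add: field_simps)
    moreover have "0 < pi / (c + 1)"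
      using that by simp
    ultimately have "ennreal (c + 1) \<le> ennreal c"
      using I by metis
    then show False
      using that by (simp only: ennreal_le_iff)
  qed
  then have "I = \<top>"
    by (cases I) auto
  then show ?thesis
    using dens_pos unfolding eve_rate_def by (simp add: sinr_scale_def I_def[symmetric] ennreal_mult_top)
qed

end

subsection \<open>From extended real interference to the SINR\<close>

lemma load_scale:
  assumes "0 \<le> s"
  shows "load H e s x g y = ennreal s * load H e 1 x g y"
proof -
  have mult: "ennreal (s * a) * c = ennreal s * (ennreal a * c)" for a :: real and c
    using assms by (simp add: ennreal_mult' mult.assoc)
  have "s * a / n * b * d = s * (1 * a / n * b * d)" "s * a * b * d = s * (1 * a * b * d)" for a b d n :: real
    by simp_all
  then have "ennreal (s * a * b * d) * c = ennreal s * (ennreal (1 * a * b * d) * c)"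
    "ennreal (s * a / n * b * d) * c = ennreal s * (ennreal (1 * a / n * b * d) * c)" for a b d n :: real and c
    by (simp_all only: mult)
  moreover have "ennreal (s * d) = ennreal s * ennreal (1 * d)" for d
    using assms by (simp add: ennreal_mult')
  ultimately show ?thesis
    unfolding load_def distrib_left ennreal_suminf_cmult[symmetric] by (simp only:)
qed

lemma ennreal_suminf_cmult_eq:
  fixes f :: "nat \<Rightarrow> real"
  assumes "\<And>n. 0 \<le> f n" "(\<Sum>n. ennreal (f n)) \<noteq> \<top>"
  shows "(\<Sum>n. ennreal (f n)) = ennreal (\<Sum>n. f n)" "0 \<le> (\<Sum>n. f n)"
  using summable_suminf_not_top[OF assms] assms(1) by (auto intro: suminf_ennreal2 suminf_nonneg)

context two_tier_network
begin

lemma AE_load_finite: "AE \<omega> in Om H. load H e 1 (all_pos H \<omega>) (all_gains H \<omega>) (all_pos H \<omega> Eves e) \<noteq> \<top>"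
proof -
  define T where "T s \<omega> = load H e s (all_pos H \<omega>) (all_gains H \<omega>) (all_pos H \<omega> Eves e)" for s \<omega>
  have [measurable]: "T s \<in> borel_measurable (Om H)" for s
    unfolding T_def by (intro measurable_load measurable_compose[OF measurable_all_pos measurable_position]) simp_all
  define B where "B = {\<omega>\<in>space (Om H). T 1 \<omega> \<noteq> \<top>}"
  have B: "B \<in> sets (Om H)" unfolding B_def by measurable
  have le: "ennreal (exp (- total_load H (inverse (real (Suc n))))) \<le> emeasure (Om H) B" for n
  proof -
    define s where "s = inverse (real (Suc n))"
    have s: "0 < s" by (simp add: s_def)
    have "ennreal (exp (- total_load H s)) = (\<integral>\<^sup>+\<omega>. ennreal (exp_neg (T s \<omega>)) \<partial>Om H)"
      unfolding T_def using s by (intro nn_integral_exp_neg_load_eve[symmetric]) simp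
    also have "\<dots> \<le> (\<integral>\<^sup>+\<omega>. indicator B \<omega> \<partial>Om H)"
    proof (rule nn_integral_mono)
      fix \<omega> assume \<omega>: "\<omega> \<in> space (Om H)"
      show "ennreal (exp_neg (T s \<omega>)) \<le> indicator B \<omega>"
      proof (cases "T 1 \<omega> = \<top>")
        case True
        then have "T s \<omega> = \<top>"
          unfolding T_def using s by (subst load_scale) (simp_all add: ennreal_mult_top)
        then show ?thesis by simp
      next
        case False
        then show ?thesis using \<omega> by (simp add: B_def)
      qed
    qed
    also have "\<dots> = emeasure (Om H) B"
      using B by simp
    finally show ?thesis unfolding s_def .
  qed
  have "(\<lambda>n. ennreal (exp (- total_load H (inverse (real (Suc n)))))) \<longlonglongrightarrow> ennreal (exp (- total_load H 0))"
    by (intro tendsto_ennrealI tendsto_exp tendsto_minus tendsto_total_load LIMSEQ_inverse_real_of_nat) simp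
  then have "ennreal (exp (- total_load H 0)) \<le> emeasure (Om H) B"
    by (rule LIMSEQ_le_const2) (use le in blast)
  then have "prob B = 1"
    by (simp add: emeasure_eq_measure antisym)
  then have "AE \<omega> in Om H. \<omega> \<in> B"
    using prob_eq_1[OF B] by blast
  then show ?thesis
    by (rule eventually_mono) (simp add: B_def T_def)
qed

lemma nn_integral_poisson_avoid:
  assumes "poisson_process (Om H) \<rho> X" "0 \<le> \<rho>"
  shows "(\<integral>\<^sup>+\<omega>. ennreal (exp_neg (\<Sum>n. \<top> * indicator {t} (X n \<omega>))) \<partial>Om H) = 1"
proof -
  have "(\<integral>\<^sup>+y. ennreal (1 - exp_neg (\<top> * indicator {t} y)) \<partial>lborel) = (\<integral>\<^sup>+y. indicator {t} y \<partial>(lborel :: plane measure))"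
    by (intro nn_integral_cong) (auto simp: indicator_def)
  also have "\<dots> = 0" by simp
  finally have 0: "(\<integral>\<^sup>+y. ennreal (1 - exp_neg (\<top> * indicator {t} y)) \<partial>(lborel :: plane measure)) = 0" .
  show ?thesis
    by (subst poisson_laplace[OF assms]) (simp_all add: 0)
qed

lemma suminf_top_indicator_eq_0:
  assumes "exp_neg (\<Sum>n. \<top> * indicator {t} (X n)) = 1"
  shows "X n \<noteq> t"
proof
  assume "X n = t"
  then have "\<top> = (\<Sum>i\<in>{n}. \<top> * indicator {t} (X i) :: ennreal)"
    by simp
  also have "\<dots> \<le> (\<Sum>n. \<top> * indicator {t} (X n))"
    by (rule sum_le_suminf) auto
  finally have "(\<Sum>n. \<top> * indicator {t} (X n)) = (\<top> :: ennreal)"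
    by (simp only: top_unique)
  then show False
    using assms by (simp only: exp_neg_top)
qed

lemma AE_eve_neq_target: "AE \<omega> in Om H. \<forall>e. pos H Eves e \<omega> \<noteq> target_pos H \<omega>"
proof -
  define F where "F x = exp_neg (\<Sum>n. \<top> * indicator {0} (x Eves n - target H x))"
    for x :: "process \<Rightarrow> nat \<Rightarrow> plane"
  note [measurable] = measurable_position
  have [measurable]: "F \<in> borel_measurable positions"
    unfolding F_def by measurable
  have "(\<integral>\<^sup>+\<omega>. ennreal (F (all_pos H \<omega>)) \<partial>Om H) =
    (\<integral>\<^sup>+\<omega>. \<integral>\<^sup>+\<omega>'. ennreal (F (\<lambda>p. if p \<in> {Eves} then all_pos H \<omega>' p else all_pos H \<omega> p)) \<partial>Om H \<partial>Om H)"
    by (rule nn_integral_resample_all_pos) measurable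
  also have "\<dots> = (\<integral>\<^sup>+\<omega>. 1 \<partial>Om H)"
  proof (rule nn_integral_cong)
    fix \<omega>
    define r where "r \<omega>' = (\<lambda>p. if p \<in> {Eves} then all_pos H \<omega>' p else all_pos H \<omega> p)" for \<omega>'
    have "target H (r \<omega>') = target H (all_pos H \<omega>)" for \<omega>'
      by (rule depends_only_target[unfolded depends_only_def, rule_format]) (auto simp: r_def)
    moreover have "r \<omega>' Eves n = pos H Eves n \<omega>'" for \<omega>' n
      by (simp add: r_def all_pos_def)
    moreover have "indicator {0} (u - v) = (indicator {v} u :: ennreal)" for u v :: plane
      by (simp add: indicator_def)
    ultimately have "(\<integral>\<^sup>+\<omega>'. ennreal (F (r \<omega>')) \<partial>Om H) = 1"
      unfolding F_def using nn_integral_poisson_avoid[OF poisson_Eves, of "target H (all_pos H \<omega>)"] dens_pos by simp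
    then show "(\<integral>\<^sup>+\<omega>'. ennreal (F (\<lambda>p. if p \<in> {Eves} then all_pos H \<omega>' p else all_pos H \<omega> p)) \<partial>Om H) = 1"
      unfolding r_def .
  qed
  finally have "(\<integral>\<^sup>+\<omega>. ennreal (F (all_pos H \<omega>)) \<partial>Om H) = 1"
    by (simp add: emeasure_space_1)
  then have "AE \<omega> in Om H. F (all_pos H \<omega>) = 1"
    by (intro AE_eq_1_if_nn_integral_eq_1) (auto simp: F_def)
  then show ?thesis
  proof (rule eventually_mono)
    fix \<omega> assume "F (all_pos H \<omega>) = 1"
    then show "\<forall>e. pos H Eves e \<omega> \<noteq> target_pos H \<omega>"
      using suminf_top_indicator_eq_0[of 0 "\<lambda>n. pos H Eves n \<omega> - target_pos H \<omega>"]
      by (simp add: F_def target_pos_eq all_pos_def)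
  qed
qed

lemma AE_gains_nonneg: "AE \<omega> in Om H. \<forall>i n. 0 \<le> gain H (From_MBS (Eve i) n) \<omega> \<and> 0 \<le> gain H (From_PBS (Eve i) n) \<omega> \<and> 0 \<le> gain H (Target i) \<omega>"
  using AE_erlang_nonneg[OF gain_MBS] AE_erlang_nonneg[OF gain_PBS] AE_erlang_nonneg[OF gain_Target]
  by (simp add: AE_all_countable)

lemma SINR_eve_le_iff:
  assumes gains: "\<forall>i n. 0 \<le> gain H (From_MBS (Eve i) n) \<omega> \<and> 0 \<le> gain H (From_PBS (Eve i) n) \<omega> \<and> 0 \<le> gain H (Target i) \<omega>"
    and fin: "load H e 1 (all_pos H \<omega>) (all_gains H \<omega>) (all_pos H \<omega> Eves e) \<noteq> \<top>"
    and neq: "pos H Eves e \<omega> \<noteq> target_pos H \<omega>"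
  shows "0 \<le> SINR_eve H e \<omega>" "0 \<le> \<gamma> \<Longrightarrow> SINR_eve H e \<omega> \<le> \<gamma> \<longleftrightarrow> state \<omega> \<in> safe \<gamma> e"
proof -
  have pos: "0 < pow_M H" "0 < pow_P H" "0 < beta H" "0 < (delta H)\<^sup>2" "0 < real (users H)"
    using pow_pos beta_pos delta_pos users_pos by auto
  define y where "y = pos H Eves e \<omega>"
  define d where "d = dist (target_pos H \<omega>) y"
  have d: "0 < d" using neq by (auto simp: d_def y_def)
  define fM where "fM n = pow_M H / real (users H) * gain H (From_MBS (Eve e) n) \<omega> *
           path_loss H (alpha1 H) (dist (pos H (MBS (Eve e)) n \<omega>) y)" for n
  define fP where "fP n = pow_P H * gain H (From_PBS (Eve e) n) \<omega> *
           path_loss H (alpha2 H) (dist (pos H (PBS (Eve e)) n \<omega>) y)" for n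
  have nn: "0 \<le> fM n" "0 \<le> fP n" for n
    using pos gains by (auto simp: fM_def fP_def path_loss_def)
  have "ennreal (1 * pow_M H / real (users H) * beta H * dist (pos H (MBS (Eve e)) n \<omega>) y powr - alpha1 H) *
      ennreal (gain H (From_MBS (Eve e) n) \<omega>) = ennreal (fM n)" for n
    using pos gains by (simp add: fM_def path_loss_def ennreal_mult[symmetric] ac_simps)
  moreover have "ennreal (1 * pow_P H * beta H * dist (pos H (PBS (Eve e)) n \<omega>) y powr - alpha2 H) *
      ennreal (gain H (From_PBS (Eve e) n) \<omega>) = ennreal (fP n)" for n
    using pos gains by (simp add: fP_def path_loss_def ennreal_mult[symmetric] ac_simps)
  ultimately have load: "load H e 1 (all_pos H \<omega>) (all_gains H \<omega>) y =
      (\<Sum>n. ennreal (fM n)) + (\<Sum>n. ennreal (fP n)) + ennreal ((delta H)\<^sup>2)"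
    unfolding load_def all_pos_def all_gains_def by simp
  then have "(\<Sum>n. ennreal (fM n)) \<noteq> \<top>" "(\<Sum>n. ennreal (fP n)) \<noteq> \<top>"
    using fin by (auto simp: y_def all_pos_def)
  note M = ennreal_suminf_cmult_eq[OF nn(1) this(1)] and P = ennreal_suminf_cmult_eq[OF nn(2) this(2)]
  define I where "I = (\<Sum>n. fM n) + (\<Sum>n. fP n) + (delta H)\<^sup>2"
  have I: "0 < I" using M(2) P(2) pos by (simp add: I_def add_nonneg_pos)
  have load1: "load H e 1 (all_pos H \<omega>) (all_gains H \<omega>) y = ennreal I"
    unfolding load M(1) P(1) I_def using M(2) P(2) by (simp add: ennreal_plus[symmetric] del: ennreal_plus)
  have SINR: "SINR_eve H e \<omega> = pow_P H * gain H (Target e) \<omega> * (beta H * d powr - alpha2 H) / I"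
    unfolding SINR_eve_def Let_def interference_M_def interference_P_def I_def fM_def fP_def d_def y_def
    by (simp add: path_loss_def)
  then show "0 \<le> SINR_eve H e \<omega>"
    using pos I gains by simp
  assume \<gamma>: "0 \<le> \<gamma>"
  have q: "0 < d powr alpha2 H" using d by simp
  have "SINR_eve H e \<omega> \<le> \<gamma> \<longleftrightarrow> gain H (Target e) \<omega> \<le> sinr_scale H \<gamma> d * I"
    unfolding SINR sinr_scale_def powr_minus using I q pos by (simp add: field_simps)
  also have "\<dots> \<longleftrightarrow> ennreal (gain H (Target e) \<omega>) \<le> ennreal (sinr_scale H \<gamma> d) * ennreal I"
    using I sinr_scale_nonneg[OF \<gamma>, of d] by (simp add: ennreal_mult[symmetric])
  also have "ennreal (sinr_scale H \<gamma> d) * ennreal I = eve_load \<gamma> (all_pos H \<omega>) (all_gains H \<omega>) e"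
    using load_scale[OF sinr_scale_nonneg[OF \<gamma>, of d], of H e "all_pos H \<omega>" "all_gains H \<omega>" y] load1
    by (simp add: eve_load_def d_def y_def target_pos_eq all_pos_def)
  finally show "SINR_eve H e \<omega> \<le> \<gamma> \<longleftrightarrow> state \<omega> \<in> safe \<gamma> e"
    by (simp add: safe_def all_gains_def)
qed

lemma AE_SINR_eve:
  "AE \<omega> in Om H. (\<forall>e. 0 \<le> SINR_eve H e \<omega>) \<and> (\<forall>\<gamma>\<ge>0. (\<forall>e. SINR_eve H e \<omega> \<le> \<gamma>) \<longleftrightarrow> state \<omega> \<in> (\<Inter>e. safe \<gamma> e))"
proof -
  have "AE \<omega> in Om H. \<forall>e. load H e 1 (all_pos H \<omega>) (all_gains H \<omega>) (all_pos H \<omega> Eves e) \<noteq> \<top>"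
    using AE_load_finite by (simp add: AE_all_countable)
  with AE_gains_nonneg AE_eve_neq_target show ?thesis
  proof eventually_elim
    case (elim \<omega>)
    then show ?case
      using SINR_eve_le_iff[OF elim(1)] by blast
  qed
qed

lemma measurable_target_pos [measurable]: "target_pos H \<in> borel_measurable (Om H)"
  unfolding target_pos_eq[abs_def] by measurable

lemma measurable_SINR_eve [measurable]: "SINR_eve H e \<in> borel_measurable (Om H)"
  unfolding SINR_eve_def Let_def interference_M_def interference_P_def path_loss_def by measurable

lemma Sup_real_not_bdd_above:
  assumes "\<not> bdd_above (X :: real set)"
  shows "Sup X = (LEAST z::real. False)"
proof -
  have "(\<lambda>z. \<forall>x\<in>X. x \<le> z) = (\<lambda>z. False)"
    using assms by (auto simp: bdd_above_def fun_eq_iff)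
  then show ?thesis by (simp only: Sup_real_def)
qed

text \<open>The supremum of an unbounded set of reals is an unspecified constant, hence the case distinction.\<close>

lemma measurable_SINR_eve_max [measurable]: "SINR_eve_max H \<in> borel_measurable (Om H)"
proof -
  define b where "b \<omega> \<longleftrightarrow> (\<exists>n::nat. \<forall>e. SINR_eve H e \<omega> \<le> real n)" for \<omega>
  have b: "bdd_above (range (\<lambda>e. SINR_eve H e \<omega>)) \<longleftrightarrow> b \<omega>" for \<omega>
  proof
    assume "bdd_above (range (\<lambda>e. SINR_eve H e \<omega>))"
    then obtain c where "\<forall>e. SINR_eve H e \<omega> \<le> c" by (auto simp: bdd_above_def)
    moreover obtain n where "c \<le> real n" using real_arch_simple by blast
    ultimately show "b \<omega>" unfolding b_def by (meson order_trans)
  qed (auto simp: b_def bdd_above_def)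
  have [measurable]: "Measurable.pred (Om H) b"
    unfolding b_def by measurable
  have "(\<lambda>\<omega>. SUP e. if b \<omega> then SINR_eve H e \<omega> else 0) \<in> borel_measurable (Om H)"
    by (rule borel_measurable_cSUP) (auto simp: b)
  then have "(\<lambda>\<omega>. if b \<omega> then SUP e. if b \<omega> then SINR_eve H e \<omega> else 0 else (LEAST z::real. False)) \<in> borel_measurable (Om H)"
    by measurable
  also have "(\<lambda>\<omega>. if b \<omega> then SUP e. if b \<omega> then SINR_eve H e \<omega> else 0 else (LEAST z::real. False)) = SINR_eve_max H"
    using Sup_real_not_bdd_above b by (auto simp: SINR_eve_max_def fun_eq_iff)
  finally show ?thesis .
qed

end

subsection \<open>Association with a PBS\<close>

definition association :: "'a hetnet \<Rightarrow> (process \<Rightarrow> nat \<Rightarrow> plane) set" where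
  "association H = {x. \<exists>n. serves H x n}"

lemma sets_association: "association H \<in> sets positions"
proof -
  have "{x \<in> space positions. \<exists>n. serves H x n} \<in> sets positions"
    by measurable
  then show ?thesis by (simp add: association_def)
qed

lemma depends_only_association: "depends_only {MBS User, PBS User} (\<lambda>x. x \<in> association H)"
  unfolding depends_only_def
proof (intro allI impI)
  fix u v :: "process \<Rightarrow> nat \<Rightarrow> plane"
  assume eq: "\<forall>i\<in>{MBS User, PBS User}. u i = v i"
  have "serves H u = serves H v"
    by (rule depends_only_serves[unfolded depends_only_def, rule_format]) (use eq in blast)
  then show "(u \<in> association H) = (v \<in> association H)"
    by (simp add: association_def)
qed

context two_tier_network
begin

lemma prob_poisson_void:
  assumes pp: "poisson_process (Om H) \<rho> X" and B: "B \<in> sets borel" "bounded B"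
  shows "prob {\<omega>\<in>space (Om H). \<forall>n. X n \<omega> \<notin> B} = exp (- (\<rho> * measure lborel B))"
proof -
  have "{\<omega>\<in>space (Om H). \<forall>n. X n \<omega> \<notin> B} = {\<omega>\<in>space (Om H). finite {n. X n \<omega> \<in> B} \<and> card {n. X n \<omega> \<in> B} = 0}"
    by auto
  then show ?thesis
    using pp[unfolded poisson_process_def, THEN conjunct2, THEN conjunct1, rule_format, OF B, of 0] by simp
qed

lemma serves_nearest:
  assumes R: "1 \<le> R" "(real (antennas H) - real (users H) + 1) * (pow_M H / real (users H)) \<le> pow_P H * R"
    and M: "\<And>n. R < norm (x (MBS User) n)"
    and P: "\<exists>n. norm (x (PBS User) n) \<le> 1" "finite {n. norm (x (PBS User) n) \<le> 1}" "\<And>n. x (PBS User) n \<noteq> 0"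
  shows "\<exists>n. serves H x n"
proof -
  let ?N = "{n. norm (x (PBS User) n) \<le> 1}"
  define k where "k = arg_min_on (\<lambda>n. norm (x (PBS User) n)) ?N"
  have ne: "?N \<noteq> {}" using P(1) by blast
  have k: "k \<in> ?N" "\<And>n. n \<in> ?N \<Longrightarrow> norm (x (PBS User) k) \<le> norm (x (PBS User) n)"
    unfolding k_def by (rule arg_min_if_finite(1)[OF P(2) ne], rule arg_min_least[OF P(2) ne])
  define \<rho> where "\<rho> = norm (x (PBS User) k)"
  have \<rho>: "0 < \<rho>" "\<rho> \<le> 1" using k P(3) by (auto simp: \<rho>_def)
  have nearest: "\<rho> \<le> norm (x (PBS User) m)" for m
  proof (cases "m \<in> ?N")
    case True
    then show ?thesis using k(2) by (simp add: \<rho>_def)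
  qed (use \<rho> in auto)
  have "avg_power_P H (norm (x (PBS User) m)) \<le> avg_power_P H \<rho>" for m
    unfolding avg_power_P_def path_loss_def
    using nearest[of m] \<rho> pow_pos beta_pos alpha_gt_2 by (intro mult_left_mono powr_mono2') auto
  moreover have "avg_power_M H (norm (x (MBS User) l)) \<le> avg_power_P H \<rho>" for l
  proof -
    define c where "c = (real (antennas H) - real (users H) + 1) * (pow_M H / real (users H))"
    define r where "r = norm (x (MBS User) l)"
    have c: "0 \<le> c" using users_le_antennas pow_pos by (auto simp: c_def)
    have r: "R < r" "1 \<le> r" using M[of l] R by (auto simp: r_def)
    have "r powr - alpha1 H \<le> r powr - 1"
      using r alpha_gt_2 by (intro powr_mono) auto
    also have "\<dots> = 1 / r"
      using r by (simp add: powr_minus_divide)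
    finally have "c * (beta H * r powr - alpha1 H) \<le> c * (beta H * (1 / r))"
      using c beta_pos by (intro mult_left_mono) auto
    also have "\<dots> \<le> pow_P H * beta H"
    proof -
      have "c \<le> pow_P H * R"
        using R(2) unfolding c_def .
      also have "\<dots> \<le> pow_P H * r"
        using r pow_pos by (intro mult_left_mono) auto
      finally have "beta H * c \<le> beta H * (pow_P H * r)"
        using beta_pos by (intro mult_left_mono) auto
      then show ?thesis
        using r by (simp add: field_simps)
    qed
    also have "\<dots> \<le> pow_P H * (beta H * \<rho> powr - alpha2 H)"
    proof -
      have "1 powr - alpha2 H \<le> \<rho> powr - alpha2 H"
        using \<rho> alpha_gt_2 by (intro powr_mono2') auto
      then show ?thesis
        using pow_pos beta_pos by simp
    qed
    finally show ?thesis
      unfolding avg_power_M_def avg_power_P_def path_loss_def c_def r_def .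
  qed
  ultimately show ?thesis
    unfolding serves_def \<rho>_def by blast
qed

lemma emeasure_association_pos: "0 < emeasure (Om H) {\<omega>\<in>space (Om H). all_pos H \<omega> \<in> association H}"
proof -
  define c where "c = (real (antennas H) - real (users H) + 1) * (pow_M H / real (users H))"
  define R where "R = max 1 (c / pow_P H)"
  have "c / pow_P H \<le> R" by (simp add: R_def)
  then have "c \<le> R * pow_P H"
    using pow_pos by (simp only: pos_divide_le_eq)
  then have R: "1 \<le> R" "(real (antennas H) - real (users H) + 1) * (pow_M H / real (users H)) \<le> pow_P H * R"
    unfolding c_def[symmetric] by (simp add: R_def, simp only: mult.commute)
  have [measurable]: "cball (0::plane) d \<in> sets borel" for d
    by simp
  define V where "V = {\<omega>\<in>space (Om H). \<forall>n. pos H (MBS User) n \<omega> \<notin> cball 0 R}"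
  define W where "W = {\<omega>\<in>space (Om H). \<forall>n. pos H (PBS User) n \<omega> \<notin> cball 0 1}"
  have [measurable]: "V \<in> sets (Om H)" "W \<in> sets (Om H)"
    unfolding V_def W_def by measurable
  have "0 < prob V"
    unfolding V_def by (subst prob_poisson_void[OF poisson_MBS]) auto
  moreover have "prob W < 1"
    unfolding W_def using dens_pos by (subst prob_poisson_void[OF poisson_PBS]) (auto simp: content_cball_pos)
  moreover have "emeasure (Om H) (V - W) = emeasure (Om H) V * emeasure (Om H) (space (Om H) - W)"
  proof -
    let ?F = "\<lambda>x. indicator {u. \<forall>n. u n \<notin> cball 0 R} (x (MBS User)) :: ennreal"
    let ?G = "\<lambda>x. indicator {u. \<exists>n. u n \<in> cball 0 1} (x (PBS User)) :: ennreal"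
    have [measurable]: "{u. \<forall>n. u n \<notin> cball 0 R} \<in> sets (PiM UNIV (\<lambda>_::nat. borel :: plane measure))"
      "{u. \<exists>n. u n \<in> cball 0 1} \<in> sets (PiM UNIV (\<lambda>_::nat. borel :: plane measure))"
    proof -
      have "{u \<in> space (PiM UNIV (\<lambda>_::nat. borel :: plane measure)). \<forall>n. u n \<notin> cball 0 R} \<in> sets (PiM UNIV (\<lambda>_::nat. borel :: plane measure))"
        "{u \<in> space (PiM UNIV (\<lambda>_::nat. borel :: plane measure)). \<exists>n. u n \<in> cball 0 1} \<in> sets (PiM UNIV (\<lambda>_::nat. borel :: plane measure))"
        by measurable
      then show "{u. \<forall>n. u n \<notin> cball 0 R} \<in> sets (PiM UNIV (\<lambda>_::nat. borel :: plane measure))"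
        "{u. \<exists>n. u n \<in> cball 0 1} \<in> sets (PiM UNIV (\<lambda>_::nat. borel :: plane measure))"
        by (simp_all add: space_PiM)
    qed
    have "emeasure (Om H) (V - W) = (\<integral>\<^sup>+\<omega>. indicator (V - W) \<omega> \<partial>Om H)"
      by simp
    also have "\<dots> = (\<integral>\<^sup>+\<omega>. ?F (\<lambda>p n. pos H p n \<omega>) * ?G (\<lambda>p n. pos H p n \<omega>) \<partial>Om H)"
      by (intro nn_integral_cong) (auto simp: V_def W_def indicator_def)
    also have "\<dots> = (\<integral>\<^sup>+\<omega>. ?F (\<lambda>p n. pos H p n \<omega>) \<partial>Om H) * (\<integral>\<^sup>+\<omega>. ?G (\<lambda>p n. pos H p n \<omega>) \<partial>Om H)"
    proof (rule nn_integral_mult_blocks[OF processes_indep, where F = ?F and G = ?G and J = "{MBS User}" and K = "{PBS User}"])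
      show "?F \<in> borel_measurable positions" "?G \<in> borel_measurable positions"
        by measurable
    qed (auto simp: depends_only_def)
    also have "(\<integral>\<^sup>+\<omega>. ?F (\<lambda>p n. pos H p n \<omega>) \<partial>Om H) = (\<integral>\<^sup>+\<omega>. indicator V \<omega> \<partial>Om H)"
      by (intro nn_integral_cong) (auto simp: V_def indicator_def)
    also have "(\<integral>\<^sup>+\<omega>. ?G (\<lambda>p n. pos H p n \<omega>) \<partial>Om H) = (\<integral>\<^sup>+\<omega>. indicator (space (Om H) - W) \<omega> \<partial>Om H)"
      by (intro nn_integral_cong) (auto simp: W_def indicator_def)
    finally show ?thesis by simp
  qed
  ultimately have "0 < emeasure (Om H) (V - W)"
    by (simp add: emeasure_eq_measure prob_compl ennreal_zero_less_mult_iff)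
  also have "\<dots> \<le> emeasure (Om H) {\<omega>\<in>space (Om H). all_pos H \<omega> \<in> association H}"
  proof (rule emeasure_mono_AE)
    have "(\<integral>\<^sup>+\<omega>. ennreal (exp_neg (\<Sum>n. \<top> * indicator {0} (pos H (PBS User) n \<omega>))) \<partial>Om H) = 1"
      using nn_integral_poisson_avoid[OF poisson_PBS] dens_pos by simp
    then have "AE \<omega> in Om H. exp_neg (\<Sum>n. \<top> * indicator {0} (pos H (PBS User) n \<omega>)) = 1"
      by (intro AE_eq_1_if_nn_integral_eq_1) auto
    moreover have "AE \<omega> in Om H. finite {n. pos H (PBS User) n \<omega> \<in> cball 0 1}"
      using dens_pos by (intro AE_poisson_finite[OF poisson_PBS]) auto
    ultimately show "AE \<omega> in Om H. \<omega> \<in> V - W \<longrightarrow> \<omega> \<in> {\<omega>\<in>space (Om H). all_pos H \<omega> \<in> association H}"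
    proof eventually_elim
      case (elim \<omega>)
      show ?case
      proof
        assume \<omega>: "\<omega> \<in> V - W"
        have "\<exists>n. serves H (all_pos H \<omega>) n"
          using R
        proof (rule serves_nearest)
          show "R < norm (all_pos H \<omega> (MBS User) n)" for n
            using \<omega> by (auto simp: V_def all_pos_def not_le)
          show "\<exists>n. norm (all_pos H \<omega> (PBS User) n) \<le> 1"
            using \<omega> by (auto simp: V_def W_def all_pos_def)
          show "finite {n. norm (all_pos H \<omega> (PBS User) n) \<le> 1}"
            using elim(2) by (simp add: all_pos_def)
          show "all_pos H \<omega> (PBS User) n \<noteq> 0" for n
            using suminf_top_indicator_eq_0[OF elim(1)] by (simp add: all_pos_def)
        qed
        then show "\<omega> \<in> {\<omega>\<in>space (Om H). all_pos H \<omega> \<in> association H}"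
          using \<omega> by (auto simp: V_def association_def)
      qed
    qed
    show "{\<omega>\<in>space (Om H). all_pos H \<omega> \<in> association H} \<in> sets (Om H)"
      using sets_association[measurable] by measurable
  qed
  finally show ?thesis .
qed

lemma AE_SINR_eve_max:
  "AE \<omega> in Om H. 0 \<le> SINR_eve_max H \<omega> \<and> (\<forall>\<gamma>\<ge>0. SINR_eve_max H \<omega> \<le> \<gamma> \<longleftrightarrow> state \<omega> \<in> (\<Inter>e. safe \<gamma> e))"
proof -
  define B where "B = {\<omega>\<in>space (Om H). \<exists>n::nat. \<forall>e. SINR_eve H e \<omega> \<le> real n}"
  have B: "B \<in> sets (Om H)" unfolding B_def by measurable
  have le: "ennreal (exp_neg (eve_rate (real n))) \<le> emeasure (Om H) B" for n
  proof -
    have "ennreal (exp_neg (eve_rate (real n))) = (\<integral>\<^sup>+\<omega>. indicator (\<Inter>e. safe (real n) e) (state \<omega>) \<partial>Om H)"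
      using nn_integral_all_safe[of "real n" UNIV] sets.top[of positions]
      by (simp add: depends_only_def emeasure_space_1)
    also have "\<dots> \<le> (\<integral>\<^sup>+\<omega>. indicator B \<omega> \<partial>Om H)"
      by (rule nn_integral_mono_AE, rule eventually_mono[OF eventually_conj[OF AE_SINR_eve AE_space]])
        (auto simp: indicator_def B_def)
    finally show ?thesis using B by simp
  qed
  have "(\<lambda>n. ennreal (exp_neg (eve_rate (real n)))) \<longlonglongrightarrow> ennreal 1"
    by (intro tendsto_ennrealI exp_neg_eve_rate_at_top)
  then have "ennreal 1 \<le> emeasure (Om H) B"
    by (rule LIMSEQ_le_const2) (use le in blast)
  then have "prob B = 1"
    by (simp add: emeasure_eq_measure antisym)
  then have "AE \<omega> in Om H. \<omega> \<in> B"
    using prob_eq_1[OF B] by blast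
  with AE_SINR_eve show ?thesis
  proof eventually_elim
    case (elim \<omega>)
    then obtain n :: nat where "\<forall>e. SINR_eve H e \<omega> \<le> real n" by (auto simp: B_def)
    then have bdd: "bdd_above (range (\<lambda>e. SINR_eve H e \<omega>))" by (auto simp: bdd_above_def)
    have iff: "SINR_eve_max H \<omega> \<le> \<gamma> \<longleftrightarrow> (\<forall>e. SINR_eve H e \<omega> \<le> \<gamma>)" for \<gamma>
      unfolding SINR_eve_max_def by (subst cSUP_le_iff[OF _ bdd]) auto
    have "0 \<le> SINR_eve H 0 \<omega>"
      using elim(1) by blast
    also have "\<dots> \<le> SINR_eve_max H \<omega>"
      unfolding SINR_eve_max_def by (rule cSUP_upper[OF UNIV_I bdd])
    finally show ?case
      using elim(1)[THEN conjunct2] by (simp only: iff simp_thms)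
  qed
qed

lemma given_PBS_eq: "given_PBS H = uniform_measure (Om H) {\<omega>\<in>space (Om H). all_pos H \<omega> \<in> association H}"
proof -
  have "serves_user H \<omega> = serves H (all_pos H \<omega>)" for \<omega>
    by (simp add: fun_eq_iff serves_user_eq)
  then show ?thesis
    by (simp only: given_PBS_def association_def mem_Collect_eq)
qed

lemma sets_given_PBS [simp, measurable_cong]: "sets (given_PBS H) = sets (Om H)"
  by (simp add: given_PBS_eq)

lemma space_given_PBS [simp]: "space (given_PBS H) = space (Om H)"
  by (simp add: given_PBS_eq)

lemma prob_space_given_PBS: "prob_space (given_PBS H)"
  unfolding given_PBS_eq using emeasure_association_pos by (intro prob_space_uniform_measure) auto

lemma AE_given_PBS:
  assumes "AE \<omega> in Om H. P \<omega>"
  shows "AE \<omega> in given_PBS H. P \<omega>"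
  unfolding given_PBS_eq using sets_association[measurable] assms
  by (intro AE_uniform_measureI) (auto elim: eventually_mono)

lemma measure_given_PBS_SINR_le:
  assumes \<gamma>: "0 \<le> \<gamma>"
  shows "measure (given_PBS H) {\<omega>\<in>space (Om H). SINR_eve_max H \<omega> \<le> \<gamma>} = exp_neg (eve_rate \<gamma>)"
proof -
  define A where "A = {\<omega>\<in>space (Om H). all_pos H \<omega> \<in> association H}"
  define S where "S = {\<omega>\<in>space (Om H). SINR_eve_max H \<omega> \<le> \<gamma>}"
  note [measurable] = sets_association
  have [measurable]: "A \<in> sets (Om H)" "S \<in> sets (Om H)"
    unfolding A_def S_def by measurable
  have "emeasure (Om H) (A \<inter> S) = (\<integral>\<^sup>+\<omega>. indicator (A \<inter> S) \<omega> \<partial>Om H)"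
    by simp
  also have "\<dots> = (\<integral>\<^sup>+\<omega>. indicator (association H) (all_pos H \<omega>) * indicator (\<Inter>e. safe \<gamma> e) (state \<omega>) \<partial>Om H)"
    by (rule nn_integral_cong_AE, rule eventually_mono[OF eventually_conj[OF AE_SINR_eve_max AE_space]])
      (use \<gamma> in \<open>auto simp: indicator_def A_def S_def\<close>)
  also have "\<dots> = emeasure (Om H) A * ennreal (exp_neg (eve_rate \<gamma>))"
    unfolding A_def by (rule nn_integral_all_safe[OF \<gamma> sets_association depends_only_association])
  finally have "prob (A \<inter> S) = prob A * exp_neg (eve_rate \<gamma>)"
    by (simp add: emeasure_eq_measure ennreal_mult[symmetric])
  moreover have "0 < prob A"
    using emeasure_association_pos by (simp add: A_def emeasure_eq_measure)
  ultimately show ?thesis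
    unfolding given_PBS_eq A_def[symmetric] S_def[symmetric]
    by (subst measure_uniform_measure) (auto simp: emeasure_eq_measure)
qed

lemma measure_given_PBS_SINR_less:
  assumes "0 < t"
  shows "measure (given_PBS H) {\<omega>\<in>space (Om H). SINR_eve_max H \<omega> < t} = exp_neg (eve_rate t)"
proof (rule antisym)
  interpret G: prob_space "given_PBS H" by (rule prob_space_given_PBS)
  show "measure (given_PBS H) {\<omega>\<in>space (Om H). SINR_eve_max H \<omega> < t} \<le> exp_neg (eve_rate t)"
    unfolding measure_given_PBS_SINR_le[OF less_imp_le[OF assms], symmetric]
    by (rule G.finite_measure_mono) auto
  define g where "g n = t - t / 2 * inverse (real (Suc n))" for n
  have g: "t / 2 \<le> g n" "g n < t" for n
  proof -
    have "t / 2 * inverse (real (Suc n)) \<le> t / 2 * 1"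
      using assms by (intro mult_left_mono) (auto simp: field_simps)
    then show "t / 2 \<le> g n" by (simp add: g_def)
    show "g n < t" using assms by (simp add: g_def)
  qed
  have "g \<longlonglongrightarrow> t - t / 2 * 0"
    unfolding g_def by (intro tendsto_diff tendsto_mult tendsto_const LIMSEQ_inverse_real_of_nat)
  then have "(\<lambda>n. exp_neg (eve_rate (g n))) \<longlonglongrightarrow> exp_neg (eve_rate t)"
    using assms g by (intro tendsto_exp_neg tendsto_eve_rate) auto
  moreover have "exp_neg (eve_rate (g n)) \<le> measure (given_PBS H) {\<omega>\<in>space (Om H). SINR_eve_max H \<omega> < t}" for n
  proof -
    have "0 \<le> g n" using g[of n] assms by linarith
    then show ?thesis
      using g[of n] by (subst measure_given_PBS_SINR_le[symmetric]) (auto intro!: G.finite_measure_mono)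
  qed
  ultimately show "exp_neg (eve_rate t) \<le> measure (given_PBS H) {\<omega>\<in>space (Om H). SINR_eve_max H \<omega> < t}"
    by (intro LIMSEQ_le_const2) auto
qed

lemma cdf_SINR_eve_max_eq:
  "cdf_SINR_eve_max H t = measure (given_PBS H) {\<omega>\<in>space (Om H). SINR_eve_max H \<omega> \<le> t}"
proof -
  have [measurable]: "SINR_eve_max H \<in> borel_measurable (given_PBS H)" by measurable
  show ?thesis
    unfolding cdf_SINR_eve_max_def cdf_def
    by (subst measure_distr) (auto intro!: arg_cong[of _ _ "measure (given_PBS H)"])
qed

lemma measure_given_PBS_less_eq_cdf:
  "measure (given_PBS H) {\<omega>\<in>space (Om H). SINR_eve_max H \<omega> < t} = cdf_SINR_eve_max H t"
proof (cases "0 < t")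
  case True
  then show ?thesis
    by (simp add: measure_given_PBS_SINR_less measure_given_PBS_SINR_le cdf_SINR_eve_max_eq)
next
  case False
  interpret G: prob_space "given_PBS H" by (rule prob_space_given_PBS)
  have "cdf_SINR_eve_max H t \<le> measure (given_PBS H) {\<omega>\<in>space (Om H). SINR_eve_max H \<omega> \<le> 0}"
    unfolding cdf_SINR_eve_max_eq using False by (intro G.finite_measure_mono) auto
  also have "\<dots> = 0"
    by (simp add: measure_given_PBS_SINR_le eve_rate_0)
  finally have "cdf_SINR_eve_max H t = 0"
    by (simp add: cdf_SINR_eve_max_eq measure_le_0_iff)
  moreover have "measure (given_PBS H) {\<omega>\<in>space (Om H). SINR_eve_max H \<omega> < t} \<le> cdf_SINR_eve_max H t"
    unfolding cdf_SINR_eve_max_eq by (intro G.finite_measure_mono) auto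
  ultimately show ?thesis
    by (simp add: measure_le_0_iff)
qed

lemma secrecy_outage_eq:
  "secrecy_outage H Rs = 1 - cdf_SINR_eve_max H (2 powr (rate_P H - Rs) - 1)"
proof -
  interpret G: prob_space "given_PBS H" by (rule prob_space_given_PBS)
  define t where "t = 2 powr (rate_P H - Rs) - 1"
  have [measurable]: "SINR_eve_max H \<in> borel_measurable (given_PBS H)" by measurable
  have "secrecy_outage H Rs = G.prob {\<omega>\<in>space (given_PBS H). t \<le> SINR_eve_max H \<omega>}"
    unfolding secrecy_outage_def
  proof (rule G.finite_measure_eq_AE)
    have "AE \<omega> in given_PBS H. 0 \<le> SINR_eve_max H \<omega>"
      using AE_SINR_eve_max by (intro AE_given_PBS) (auto elim: eventually_mono)
    then show "AE \<omega> in given_PBS H. \<omega> \<in> {\<omega>\<in>space (given_PBS H). rate_P H - log 2 (1 + SINR_eve_max H \<omega>) \<le> Rs} \<longleftrightarrow>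
        \<omega> \<in> {\<omega>\<in>space (given_PBS H). t \<le> SINR_eve_max H \<omega>}"
    proof (rule eventually_mono)
      fix \<omega> assume "0 \<le> SINR_eve_max H \<omega>"
      then have "rate_P H - Rs \<le> log 2 (1 + SINR_eve_max H \<omega>) \<longleftrightarrow> 2 powr (rate_P H - Rs) \<le> 1 + SINR_eve_max H \<omega>"
        by (intro le_log_iff) auto
      then have "rate_P H - log 2 (1 + SINR_eve_max H \<omega>) \<le> Rs \<longleftrightarrow> t \<le> SINR_eve_max H \<omega>"
        unfolding t_def by linarith
      then show "\<omega> \<in> {\<omega>\<in>space (given_PBS H). rate_P H - log 2 (1 + SINR_eve_max H \<omega>) \<le> Rs} \<longleftrightarrow>
        \<omega> \<in> {\<omega>\<in>space (given_PBS H). t \<le> SINR_eve_max H \<omega>}"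
        by blast
    qed
  qed measurable
  also have "{\<omega>\<in>space (given_PBS H). t \<le> SINR_eve_max H \<omega>} =
      space (given_PBS H) - {\<omega>\<in>space (given_PBS H). SINR_eve_max H \<omega> < t}"
    by auto
  also have "G.prob \<dots> = 1 - G.prob {\<omega>\<in>space (given_PBS H). SINR_eve_max H \<omega> < t}"
    by (rule G.prob_compl) measurable
  finally show ?thesis
    using measure_given_PBS_less_eq_cdf[of t] by (simp add: t_def)
qed

end

theorem theorem2:
  fixes H :: "'a hetnet" and Rs :: real
  assumes "two_tier_network H"
  shows "secrecy_outage H Rs = 1 - cdf_SINR_eve_max H (2 powr (rate_P H - Rs) - 1)
    \<and> (\<forall>\<gamma>\<ge>0. cdf_SINR_eve_max H \<gamma> =
         exp_neg (ennreal (2 * pi * dens_E H) *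
                  (\<integral>\<^sup>+x\<in>{0<..}. ennreal (exp (- exponent H \<gamma> x) * x) \<partial>lborel)))"
proof -
  interpret two_tier_network H by (rule assms)
  have "cdf_SINR_eve_max H \<gamma> = exp_neg (ennreal (2 * pi * dens_E H) *
      (\<integral>\<^sup>+x\<in>{0<..}. ennreal (exp (- exponent H \<gamma> x) * x) \<partial>lborel))" if "0 \<le> \<gamma>" for \<gamma>
    using that by (simp only: cdf_SINR_eve_max_eq measure_given_PBS_SINR_le eve_rate_eq)
  then show ?thesis
    using secrecy_outage_eq by blast
qed

end
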